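(* An SMMV-algebra is subdirectly irreducible if and only if it is of one of the types $\mathcal{I}$, $\mathcal{L}$ and $\mathcal{D}$. Moreover, these three types are mutually disjoint.
   Context: An MV-algebra is $\mathbf{A}=(A,\oplus,\neg,0)$ with $(A,\oplus,0)$ a commutative monoid, $\neg\neg x=x$, $x\oplus 1=1$ where $1=\neg 0$, and $(x\to y)\to y=(y\to x)\to x$ where $x\to y=\neg x\oplus y$. Put $x\odot y=\neg(\neg x\oplus\neg y)$, $x\vee y=(x\to y)\to y$. An MV-chain is a linearly ordered MV-algebra. A filter is a subset $F\ni 1$ such that $a,a\to b\in F$ imply $b\in F$; an MV-algebra is local if it has exactly one maximal proper filter (equivalently exactly one maximal ideal). An SMMV-algebra is a pair $(\mathbf{A},\tau)$ where $\mathbf{A}$ is an MV-algebra and $\tau$ is an idempotent endomorphism of $\mathbf{A}$, viewed as an algebra in the signature $(\oplus,\neg,0,\tau)$. $\tau(\mathbf{A})$ is the MV-subalgebra with universe $\tau(A)$; $F_\tau(A)=\{a\in A:\tau(a)=1\}$ and $\mathbf{F}_\tau(\mathbf{A})=(F_\tau(A),\odot,\to,1)$ is a (Wajsberg) hoop. $\mathbf{F}_\tau(\mathbf{A})$ and $\tau(\mathbf{A})$ have the disjunction property if for all $x\in F_\tau(A)$, $y\in\tau(A)$: $x\vee y=1$ implies $x=1$ or $y=1$. An SMMV-algebra is diagonal if it has the form $(\mathbf{B}\times\mathbf{C},\tau)$ with $\mathbf{B}\subseteq\mathbf{C}$ MV-chains ($\mathbf{B}$ a subalgebra of $\mathbf{C}$)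 and $\tau(b,c)=(b,b)$; it is subdiagonal if it is (isomorphic to) a subalgebra of a diagonal SMMV-algebra. Types (understood up to isomorphism): Type $\mathcal{I}$: $\mathbf{A}$ is a subdirectly irreducible MV-algebra and $\tau$ is the identity on $A$. Type $\mathcal{L}$: $(\mathbf{A},\tau)$ is subdiagonal, $\mathbf{A}$ is a local MV-algebra, $\mathbf{F}_\tau(\mathbf{A})$ is a nontrivial subdirectly irreducible hoop, and $\mathbf{F}_\tau(\mathbf{A})$ and $\tau(\mathbf{A})$ have the disjunction property. Type $\mathcal{D}$: $\mathbf{A}=\mathbf{B}\times\mathbf{C}$ where $\mathbf{C}$ is a subdirectly irreducible MV-algebra, $\mathbf{B}$ is a subalgebra of $\mathbf{C}$, and $\tau(b,c)=(b,b)$. Convention: an algebra is subdirectly irreducible if it is nontrivial and has a least congruence among those different from the identity congruence. *)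

theory Defs
  imports "HOL-Algebra.Group"
begin

section \<open>Congruences and subdirect irreducibility\<close>

text \<open>An algebra is given by its carrier, its set of unary and its set of binary basic operations;
  constants impose no condition on congruences.\<close>

definition congruences :: "'a set \<Rightarrow> ('a \<Rightarrow> 'a) set \<Rightarrow> ('a \<Rightarrow> 'a \<Rightarrow> 'a) set \<Rightarrow> 'a rel set" where
  "congruences X U B = {\<theta>. equiv X \<theta> \<and>
     (\<forall>f\<in>U. \<forall>(x, x')\<in>\<theta>. (f x, f x') \<in> \<theta>) \<and>
     (\<forall>f\<in>B. \<forall>(x, x')\<in>\<theta>. \<forall>(y, y')\<in>\<theta>. (f x y, f x' y') \<in> \<theta>)}"

definition nontrivial :: "'a set \<Rightarrow> bool" where
  "nontrivial X \<longleftrightarrow> (\<exists>x\<in>X. \<exists>y\<in>X. x \<noteq> y)"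

definition subdirectly_irreducible ::
    "'a set \<Rightarrow> ('a \<Rightarrow> 'a) set \<Rightarrow> ('a \<Rightarrow> 'a \<Rightarrow> 'a) set \<Rightarrow> bool" where
  "subdirectly_irreducible X U B \<longleftrightarrow> nontrivial X \<and>
     (\<exists>\<mu> \<in> congruences X U B - {Id_on X}. \<forall>\<theta> \<in> congruences X U B - {Id_on X}. \<mu> \<subseteq> \<theta>)"


section \<open>MV-algebras\<close>

record 'a mv_algebra = "'a partial_object" +
  oplus :: "'a \<Rightarrow> 'a \<Rightarrow> 'a" (infixl \<open>\<oplus>\<index>\<close> 65)
  neg :: "'a \<Rightarrow> 'a" (\<open>\<sim>\<index> _\<close> [80] 80)
  mv_zero :: 'a (\<open>\<zero>\<index>\<close>)

definition mv_one :: "('a, 'm) mv_algebra_scheme \<Rightarrow> 'a" where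
  "mv_one A = \<sim>\<^bsub>A\<^esub> \<zero>\<^bsub>A\<^esub>"

definition mv_imp :: "('a, 'm) mv_algebra_scheme \<Rightarrow> 'a \<Rightarrow> 'a \<Rightarrow> 'a" (infixr \<open>\<leadsto>\<index>\<close> 60) where
  "x \<leadsto>\<^bsub>A\<^esub> y = (\<sim>\<^bsub>A\<^esub> x) \<oplus>\<^bsub>A\<^esub> y"

definition mv_odot :: "('a, 'm) mv_algebra_scheme \<Rightarrow> 'a \<Rightarrow> 'a \<Rightarrow> 'a" (infixl \<open>\<odot>\<index>\<close> 70) where
  "x \<odot>\<^bsub>A\<^esub> y = \<sim>\<^bsub>A\<^esub> ((\<sim>\<^bsub>A\<^esub> x) \<oplus>\<^bsub>A\<^esub> (\<sim>\<^bsub>A\<^esub> y))"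

definition mv_join :: "('a, 'm) mv_algebra_scheme \<Rightarrow> 'a \<Rightarrow> 'a \<Rightarrow> 'a" (infixl \<open>\<curlyvee>\<index>\<close> 65) where
  "x \<curlyvee>\<^bsub>A\<^esub> y = (x \<leadsto>\<^bsub>A\<^esub> y) \<leadsto>\<^bsub>A\<^esub> y"

text \<open>The natural order of an MV-algebra.\<close>

definition mv_le :: "('a, 'm) mv_algebra_scheme \<Rightarrow> 'a \<Rightarrow> 'a \<Rightarrow> bool" where
  "mv_le A x y \<longleftrightarrow> x \<leadsto>\<^bsub>A\<^esub> y = mv_one A"

locale mv_algebra =
  fixes A (structure)
  assumes oplus_comm_monoid:
      "comm_monoid \<lparr>carrier = carrier A, monoid.mult = oplus A, one = mv_zero A\<rparr>"
    and neg_closed: "x \<in> carrier A \<Longrightarrow> \<sim> x \<in> carrier A"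
    and neg_neg: "x \<in> carrier A \<Longrightarrow> \<sim> \<sim> x = x"
    and oplus_one: "x \<in> carrier A \<Longrightarrow> x \<oplus> mv_one A = mv_one A"
    and imp_imp: "\<lbrakk>x \<in> carrier A; y \<in> carrier A\<rbrakk> \<Longrightarrow> (x \<leadsto> y) \<leadsto> y = (y \<leadsto> x) \<leadsto> x"

definition mv_chain :: "('a, 'm) mv_algebra_scheme \<Rightarrow> bool" where
  "mv_chain A \<longleftrightarrow> mv_algebra A \<and> (\<forall>x\<in>carrier A. \<forall>y\<in>carrier A. mv_le A x y \<or> mv_le A y x)"

definition mv_filter :: "('a, 'm) mv_algebra_scheme \<Rightarrow> 'a set \<Rightarrow> bool" where
  "mv_filter A F \<longleftrightarrow> F \<subseteq> carrier A \<and> mv_one A \<in> F \<and>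
     (\<forall>a\<in>carrier A. \<forall>b\<in>carrier A. a \<in> F \<and> a \<leadsto>\<^bsub>A\<^esub> b \<in> F \<longrightarrow> b \<in> F)"

definition maximal_filter :: "('a, 'm) mv_algebra_scheme \<Rightarrow> 'a set \<Rightarrow> bool" where
  "maximal_filter A F \<longleftrightarrow> mv_filter A F \<and> F \<noteq> carrier A \<and>
     (\<forall>G. mv_filter A G \<and> G \<noteq> carrier A \<and> F \<subseteq> G \<longrightarrow> G = F)"

definition mv_local :: "('a, 'm) mv_algebra_scheme \<Rightarrow> bool" where
  "mv_local A \<longleftrightarrow> mv_algebra A \<and> (\<exists>!F. maximal_filter A F)"

definition mv_subdirectly_irreducible :: "('a, 'm) mv_algebra_scheme \<Rightarrow> bool" where
  "mv_subdirectly_irreducible A \<longleftrightarrow>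
     mv_algebra A \<and> subdirectly_irreducible (carrier A) {neg A} {oplus A}"

definition mv_subalgebra :: "'a set \<Rightarrow> ('a, 'm) mv_algebra_scheme \<Rightarrow> bool" where
  "mv_subalgebra B A \<longleftrightarrow> B \<subseteq> carrier A \<and> \<zero>\<^bsub>A\<^esub> \<in> B \<and>
     (\<forall>x\<in>B. \<sim>\<^bsub>A\<^esub> x \<in> B) \<and> (\<forall>x\<in>B. \<forall>y\<in>B. x \<oplus>\<^bsub>A\<^esub> y \<in> B)"

definition mv_hom ::
    "('a, 'm) mv_algebra_scheme \<Rightarrow> ('b, 'n) mv_algebra_scheme \<Rightarrow> ('a \<Rightarrow> 'b) set" where
  "mv_hom A B = {h \<in> carrier A \<rightarrow> carrier B. h \<zero>\<^bsub>A\<^esub> = \<zero>\<^bsub>B\<^esub> \<and>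
     (\<forall>x\<in>carrier A. h (\<sim>\<^bsub>A\<^esub> x) = \<sim>\<^bsub>B\<^esub> h x) \<and>
     (\<forall>x\<in>carrier A. \<forall>y\<in>carrier A. h (x \<oplus>\<^bsub>A\<^esub> y) = h x \<oplus>\<^bsub>B\<^esub> h y)}"

definition mv_prod :: "'a mv_algebra \<Rightarrow> 'b mv_algebra \<Rightarrow> ('a \<times> 'b) mv_algebra" where
  "mv_prod B C =
     \<lparr>carrier = carrier B \<times> carrier C,
      oplus = (\<lambda>(b, c) (b', c'). (b \<oplus>\<^bsub>B\<^esub> b', c \<oplus>\<^bsub>C\<^esub> c')),
      neg = (\<lambda>(b, c). (\<sim>\<^bsub>B\<^esub> b, \<sim>\<^bsub>C\<^esub> c)),
      mv_zero = (\<zero>\<^bsub>B\<^esub>, \<zero>\<^bsub>C\<^esub>)\<rparr>"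


section \<open>SMMV-algebras\<close>

definition smmv_algebra :: "('a, 'm) mv_algebra_scheme \<Rightarrow> ('a \<Rightarrow> 'a) \<Rightarrow> bool" where
  "smmv_algebra A \<tau> \<longleftrightarrow> mv_algebra A \<and> \<tau> \<in> mv_hom A A \<and> (\<forall>x\<in>carrier A. \<tau> (\<tau> x) = \<tau> x)"

definition smmv_subdirectly_irreducible ::
    "('a, 'm) mv_algebra_scheme \<Rightarrow> ('a \<Rightarrow> 'a) \<Rightarrow> bool" where
  "smmv_subdirectly_irreducible A \<tau> \<longleftrightarrow>
     smmv_algebra A \<tau> \<and> subdirectly_irreducible (carrier A) {neg A, \<tau>} {oplus A}"

definition smmv_subalgebra :: "'a set \<Rightarrow> ('a, 'm) mv_algebra_scheme \<Rightarrow> ('a \<Rightarrow> 'a) \<Rightarrow> bool" where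
  "smmv_subalgebra S A \<tau> \<longleftrightarrow> mv_subalgebra S A \<and> (\<forall>x\<in>S. \<tau> x \<in> S)"

definition smmv_isomorphic :: "('a, 'm) mv_algebra_scheme \<Rightarrow> ('a \<Rightarrow> 'a) \<Rightarrow>
    ('b, 'n) mv_algebra_scheme \<Rightarrow> ('b \<Rightarrow> 'b) \<Rightarrow> bool" where
  "smmv_isomorphic A \<tau> B \<sigma> \<longleftrightarrow>
     (\<exists>h\<in>mv_hom A B. bij_betw h (carrier A) (carrier B) \<and> (\<forall>x\<in>carrier A. h (\<tau> x) = \<sigma> (h x)))"

definition F_tau :: "('a, 'm) mv_algebra_scheme \<Rightarrow> ('a \<Rightarrow> 'a) \<Rightarrow> 'a set" where
  "F_tau A \<tau> = {a \<in> carrier A. \<tau> a = mv_one A}"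

text \<open>Subdirect irreducibility of the hoop on \<open>F_tau A \<tau>\<close> with operations \<open>\<odot>\<close>, \<open>\<leadsto>\<close>, \<open>1\<close>.\<close>

definition F_tau_subdirectly_irreducible ::
    "('a, 'm) mv_algebra_scheme \<Rightarrow> ('a \<Rightarrow> 'a) \<Rightarrow> bool" where
  "F_tau_subdirectly_irreducible A \<tau> \<longleftrightarrow>
     subdirectly_irreducible (F_tau A \<tau>) {} {mv_odot A, mv_imp A}"

definition disjunction_property :: "('a, 'm) mv_algebra_scheme \<Rightarrow> ('a \<Rightarrow> 'a) \<Rightarrow> bool" where
  "disjunction_property A \<tau> \<longleftrightarrow>
     (\<forall>x\<in>F_tau A \<tau>. \<forall>y\<in>\<tau> ` carrier A.
        x \<curlyvee>\<^bsub>A\<^esub> y = mv_one A \<longrightarrow> x = mv_one A \<or> y = mv_one A)"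

definition diag_op :: "'a \<times> 'a \<Rightarrow> 'a \<times> 'a" where
  "diag_op = (\<lambda>(b, c). (b, b))"

definition diagonal :: "('a \<times> 'a) mv_algebra \<Rightarrow> ('a \<times> 'a \<Rightarrow> 'a \<times> 'a) \<Rightarrow> bool" where
  "diagonal D \<sigma> \<longleftrightarrow>
     (\<exists>B C. mv_chain C \<and> mv_subalgebra B C \<and> mv_chain (C\<lparr>carrier := B\<rparr>) \<and>
        D = mv_prod (C\<lparr>carrier := B\<rparr>) C \<and> \<sigma> = diag_op)"

text \<open>The chain \<open>C\<close> witnessing that an algebra over \<open>'a\<close> is subdiagonal, or of type D, is sought
  over \<open>'a\<close> as well, since HOL cannot quantify over types. This is no restriction: see \<open>subdiagonal_any_type\<close> and \<open>type_D_any_type\<close>.\<close>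

definition subdiagonal :: "'a mv_algebra \<Rightarrow> ('a \<Rightarrow> 'a) \<Rightarrow> bool" where
  "subdiagonal A \<tau> \<longleftrightarrow>
     (\<exists>(D :: ('a \<times> 'a) mv_algebra) \<sigma> S. diagonal D \<sigma> \<and> smmv_subalgebra S D \<sigma> \<and>
        smmv_isomorphic A \<tau> (D\<lparr>carrier := S\<rparr>) \<sigma>)"

definition type_I :: "'a mv_algebra \<Rightarrow> ('a \<Rightarrow> 'a) \<Rightarrow> bool" where
  "type_I A \<tau> \<longleftrightarrow> mv_subdirectly_irreducible A \<and> (\<forall>x\<in>carrier A. \<tau> x = x)"

definition type_L :: "'a mv_algebra \<Rightarrow> ('a \<Rightarrow> 'a) \<Rightarrow> bool" where
  "type_L A \<tau> \<longleftrightarrow> subdiagonal A \<tau> \<and> mv_local A \<and>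
     nontrivial (F_tau A \<tau>) \<and> F_tau_subdirectly_irreducible A \<tau> \<and> disjunction_property A \<tau>"

definition type_D :: "'a mv_algebra \<Rightarrow> ('a \<Rightarrow> 'a) \<Rightarrow> bool" where
  "type_D A \<tau> \<longleftrightarrow>
     (\<exists>B (C :: 'a mv_algebra). mv_subdirectly_irreducible C \<and> mv_subalgebra B C \<and>
        smmv_isomorphic A \<tau> (mv_prod (C\<lparr>carrier := B\<rparr>) C) diag_op)"


section \<open>Independence of the type of the witnesses\<close>

definition mv_isomorphism ::
    "('a, 'm) mv_algebra_scheme \<Rightarrow> ('b, 'n) mv_algebra_scheme \<Rightarrow> ('a \<Rightarrow> 'b) \<Rightarrow> bool" where
  "mv_isomorphism A B h \<longleftrightarrow> h \<in> mv_hom A B \<and> bij_betw h (carrier A) (carrier B)"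

lemma mv_algebra_alt:
  "mv_algebra A \<longleftrightarrow>
    \<zero>\<^bsub>A\<^esub> \<in> carrier A \<and> (\<forall>x\<in>carrier A. \<sim>\<^bsub>A\<^esub> x \<in> carrier A) \<and>
    (\<forall>x\<in>carrier A. \<forall>y\<in>carrier A. x \<oplus>\<^bsub>A\<^esub> y \<in> carrier A) \<and>
    (\<forall>x\<in>carrier A. \<forall>y\<in>carrier A. \<forall>z\<in>carrier A.
       x \<oplus>\<^bsub>A\<^esub> y \<oplus>\<^bsub>A\<^esub> z = x \<oplus>\<^bsub>A\<^esub> (y \<oplus>\<^bsub>A\<^esub> z)) \<and>
    (\<forall>x\<in>carrier A. \<forall>y\<in>carrier A. x \<oplus>\<^bsub>A\<^esub> y = y \<oplus>\<^bsub>A\<^esub> x) \<and>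
    (\<forall>x\<in>carrier A. \<zero>\<^bsub>A\<^esub> \<oplus>\<^bsub>A\<^esub> x = x) \<and> (\<forall>x\<in>carrier A. x \<oplus>\<^bsub>A\<^esub> \<zero>\<^bsub>A\<^esub> = x) \<and>
    (\<forall>x\<in>carrier A. \<sim>\<^bsub>A\<^esub> \<sim>\<^bsub>A\<^esub> x = x) \<and>
    (\<forall>x\<in>carrier A. x \<oplus>\<^bsub>A\<^esub> mv_one A = mv_one A) \<and>
    (\<forall>x\<in>carrier A. \<forall>y\<in>carrier A.
      (x \<leadsto>\<^bsub>A\<^esub> y) \<leadsto>\<^bsub>A\<^esub> y = (y \<leadsto>\<^bsub>A\<^esub> x) \<leadsto>\<^bsub>A\<^esub> x)"
  (is "_ \<longleftrightarrow> ?ax")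
proof
  assume "mv_algebra A"
  then interpret mv_algebra A .
  interpret comm_monoid "\<lparr>carrier = carrier A, monoid.mult = oplus A, one = mv_zero A\<rparr>"
    by (rule oplus_comm_monoid)
  note monoid = one_closed m_closed m_assoc m_comm l_one r_one
  show ?ax
    by (intro conjI ballI;
        (rule monoid[unfolded monoid.simps partial_object.simps] neg_closed neg_neg oplus_one imp_imp;
         assumption))
next
  assume ax: ?ax
  have "comm_monoid \<lparr>carrier = carrier A, monoid.mult = oplus A, one = mv_zero A\<rparr>"
    by (rule comm_monoidI; unfold monoid.simps partial_object.simps; use ax in blast)
  then show "mv_algebra A"
    by (rule mv_algebra.intro; use ax in blast)
qed

lemma mv_subalgebra_algebra:
  assumes "mv_algebra C" "mv_subalgebra B C"
  shows "mv_algebra (C\<lparr>carrier := B\<rparr>)"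
proof -
  have sub: "x \<in> carrier C" if "x \<in> B" for x
    using assms(2) that by (auto simp: mv_subalgebra_def)
  note C = assms(1)[unfolded mv_algebra_alt mv_imp_def mv_one_def]
    and B = assms(2)[unfolded mv_subalgebra_def]
  have
    "\<zero>\<^bsub>C\<^esub> \<in> B" "\<forall>x\<in>B. \<sim>\<^bsub>C\<^esub> x \<in> B" "\<forall>x\<in>B. \<forall>y\<in>B. x \<oplus>\<^bsub>C\<^esub> y \<in> B"
    using B by blast+
  moreover have
    "\<forall>x\<in>B. \<forall>y\<in>B. \<forall>z\<in>B. x \<oplus>\<^bsub>C\<^esub> y \<oplus>\<^bsub>C\<^esub> z = x \<oplus>\<^bsub>C\<^esub> (y \<oplus>\<^bsub>C\<^esub> z)"
    "\<forall>x\<in>B. \<forall>y\<in>B. x \<oplus>\<^bsub>C\<^esub> y = y \<oplus>\<^bsub>C\<^esub> x"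
    "\<forall>x\<in>B. \<zero>\<^bsub>C\<^esub> \<oplus>\<^bsub>C\<^esub> x = x" "\<forall>x\<in>B. x \<oplus>\<^bsub>C\<^esub> \<zero>\<^bsub>C\<^esub> = x"
    "\<forall>x\<in>B. \<sim>\<^bsub>C\<^esub> \<sim>\<^bsub>C\<^esub> x = x"
    "\<forall>x\<in>B. x \<oplus>\<^bsub>C\<^esub> \<sim>\<^bsub>C\<^esub> \<zero>\<^bsub>C\<^esub> = \<sim>\<^bsub>C\<^esub> \<zero>\<^bsub>C\<^esub>"
    "\<forall>x\<in>B. \<forall>y\<in>B. \<sim>\<^bsub>C\<^esub> (\<sim>\<^bsub>C\<^esub> x \<oplus>\<^bsub>C\<^esub> y) \<oplus>\<^bsub>C\<^esub> y = \<sim>\<^bsub>C\<^esub> (\<sim>\<^bsub>C\<^esub> y \<oplus>\<^bsub>C\<^esub> x) \<oplus>\<^bsub>C\<^esub> x"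
    using C sub by blast+
  moreover have "carrier (C\<lparr>carrier := B\<rparr>) = B" "oplus (C\<lparr>carrier := B\<rparr>) = oplus C"
    "neg (C\<lparr>carrier := B\<rparr>) = neg C" "mv_zero (C\<lparr>carrier := B\<rparr>) = mv_zero C"
    by simp_all
  ultimately show ?thesis
    unfolding mv_algebra_alt mv_imp_def mv_one_def by (simp only:)
qed

lemma mv_subalgebra_chain:
  assumes "mv_chain C" "mv_subalgebra B C"
  shows "mv_chain (C\<lparr>carrier := B\<rparr>)"
proof -
  have "x \<in> carrier C" if "x \<in> B" for x
    using assms(2) that by (auto simp: mv_subalgebra_def)
  moreover have "mv_le (C\<lparr>carrier := B\<rparr>) x y = mv_le C x y" for x y
    by (simp add: mv_le_def mv_imp_def mv_one_def)
  moreover have "mv_algebra (C\<lparr>carrier := B\<rparr>)"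
    using assms by (intro mv_subalgebra_algebra) (auto simp: mv_chain_def)
  ultimately show ?thesis using assms(1) by (simp add: mv_chain_def)
qed

context
  fixes A :: "('a, 'm) mv_algebra_scheme" and B :: "('b, 'n) mv_algebra_scheme" and h
  assumes iso: "mv_isomorphism A B h" and A: "mv_algebra A"
begin

lemma iso_simps:
  "h \<zero>\<^bsub>A\<^esub> = \<zero>\<^bsub>B\<^esub>" "h (mv_one A) = mv_one B"
  "x \<in> carrier A \<Longrightarrow> h (\<sim>\<^bsub>A\<^esub> x) = \<sim>\<^bsub>B\<^esub> h x"
  "x \<in> carrier A \<Longrightarrow> y \<in> carrier A \<Longrightarrow> h (x \<oplus>\<^bsub>A\<^esub> y) = h x \<oplus>\<^bsub>B\<^esub> h y"
  "x \<in> carrier A \<Longrightarrow> y \<in> carrier A \<Longrightarrow> h (x \<leadsto>\<^bsub>A\<^esub> y) = h x \<leadsto>\<^bsub>B\<^esub> h y"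
proof -
  have zero: "h \<zero>\<^bsub>A\<^esub> = \<zero>\<^bsub>B\<^esub>"
    and neg: "\<And>x. x \<in> carrier A \<Longrightarrow> h (\<sim>\<^bsub>A\<^esub> x) = \<sim>\<^bsub>B\<^esub> h x"
    and oplus: "\<And>x y. x \<in> carrier A \<Longrightarrow> y \<in> carrier A \<Longrightarrow> h (x \<oplus>\<^bsub>A\<^esub> y) = h x \<oplus>\<^bsub>B\<^esub> h y"
    using iso unfolding mv_isomorphism_def mv_hom_def by blast+
  have cl: "\<zero>\<^bsub>A\<^esub> \<in> carrier A" "\<And>x. x \<in> carrier A \<Longrightarrow> \<sim>\<^bsub>A\<^esub> x \<in> carrier A"
    using A unfolding mv_algebra_alt by blast+
  show "h \<zero>\<^bsub>A\<^esub> = \<zero>\<^bsub>B\<^esub>" by (rule zero)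
  show "h (mv_one A) = mv_one B" by (simp only: mv_one_def neg cl zero)
  show "x \<in> carrier A \<Longrightarrow> h (\<sim>\<^bsub>A\<^esub> x) = \<sim>\<^bsub>B\<^esub> h x" by (rule neg)
  show "x \<in> carrier A \<Longrightarrow> y \<in> carrier A \<Longrightarrow> h (x \<oplus>\<^bsub>A\<^esub> y) = h x \<oplus>\<^bsub>B\<^esub> h y" by (rule oplus)
  show "x \<in> carrier A \<Longrightarrow> y \<in> carrier A \<Longrightarrow> h (x \<leadsto>\<^bsub>A\<^esub> y) = h x \<leadsto>\<^bsub>B\<^esub> h y"
    by (simp only: mv_imp_def neg oplus cl)
qed

lemma iso_carrier: "carrier B = h ` carrier A" "inj_on h (carrier A)"
  using iso by (auto simp: mv_isomorphism_def bij_betw_def)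

lemma A_closed:
  "\<zero>\<^bsub>A\<^esub> \<in> carrier A" "mv_one A \<in> carrier A"
  "x \<in> carrier A \<Longrightarrow> \<sim>\<^bsub>A\<^esub> x \<in> carrier A"
  "x \<in> carrier A \<Longrightarrow> y \<in> carrier A \<Longrightarrow> x \<oplus>\<^bsub>A\<^esub> y \<in> carrier A"
  "x \<in> carrier A \<Longrightarrow> y \<in> carrier A \<Longrightarrow> x \<leadsto>\<^bsub>A\<^esub> y \<in> carrier A"
  using A unfolding mv_algebra_alt mv_one_def mv_imp_def by blast+

lemma iso_algebra: "mv_algebra B"
proof -
  have *: "(\<forall>x\<in>carrier B. P x) \<longleftrightarrow> (\<forall>x\<in>carrier A. P (h x))" for P
    by (simp add: iso_carrier)
  note to_A = iso_simps(1,2)[symmetric] iso_simps(3-5)[symmetric] A_closed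
  note ax = A[unfolded mv_algebra_alt]
  have cl: "h x \<in> carrier B" if "x \<in> carrier A" for x
    using that by (simp add: iso_carrier(1))
  have "\<zero>\<^bsub>B\<^esub> \<in> carrier B" "\<forall>x\<in>carrier A. \<sim>\<^bsub>B\<^esub> h x \<in> carrier B"
    "\<forall>x\<in>carrier A. \<forall>y\<in>carrier A. h x \<oplus>\<^bsub>B\<^esub> h y \<in> carrier B"
    by ((intro ballI)?, simp only: to_A cl)+
  moreover have "h x \<oplus>\<^bsub>B\<^esub> h y \<oplus>\<^bsub>B\<^esub> h z = h x \<oplus>\<^bsub>B\<^esub> (h y \<oplus>\<^bsub>B\<^esub> h z)"
    if that: "x \<in> carrier A" "y \<in> carrier A" "z \<in> carrier A" for x y z
  proof -
    have "x \<oplus>\<^bsub>A\<^esub> y \<oplus>\<^bsub>A\<^esub> z = x \<oplus>\<^bsub>A\<^esub> (y \<oplus>\<^bsub>A\<^esub> z)" using ax that by blast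
    then show ?thesis using that by (simp only: to_A)
  qed
  moreover have "h x \<oplus>\<^bsub>B\<^esub> h y = h y \<oplus>\<^bsub>B\<^esub> h x"
    if that: "x \<in> carrier A" "y \<in> carrier A" for x y
  proof -
    have "x \<oplus>\<^bsub>A\<^esub> y = y \<oplus>\<^bsub>A\<^esub> x" using ax that by blast
    then show ?thesis using that by (simp only: to_A)
  qed
  moreover have "\<zero>\<^bsub>B\<^esub> \<oplus>\<^bsub>B\<^esub> h x = h x" "h x \<oplus>\<^bsub>B\<^esub> \<zero>\<^bsub>B\<^esub> = h x" "\<sim>\<^bsub>B\<^esub> \<sim>\<^bsub>B\<^esub> h x = h x"
    "h x \<oplus>\<^bsub>B\<^esub> mv_one B = mv_one B" if that: "x \<in> carrier A" for x
  proof -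
    have "\<zero>\<^bsub>A\<^esub> \<oplus>\<^bsub>A\<^esub> x = x" "x \<oplus>\<^bsub>A\<^esub> \<zero>\<^bsub>A\<^esub> = x" "\<sim>\<^bsub>A\<^esub> \<sim>\<^bsub>A\<^esub> x = x"
      "x \<oplus>\<^bsub>A\<^esub> mv_one A = mv_one A"
      using ax that by blast+
    then show "\<zero>\<^bsub>B\<^esub> \<oplus>\<^bsub>B\<^esub> h x = h x" "h x \<oplus>\<^bsub>B\<^esub> \<zero>\<^bsub>B\<^esub> = h x" "\<sim>\<^bsub>B\<^esub> \<sim>\<^bsub>B\<^esub> h x = h x"
      "h x \<oplus>\<^bsub>B\<^esub> mv_one B = mv_one B"
      using that by (simp_all only: to_A)
  qed
  moreover have "(h x \<leadsto>\<^bsub>B\<^esub> h y) \<leadsto>\<^bsub>B\<^esub> h y = (h y \<leadsto>\<^bsub>B\<^esub> h x) \<leadsto>\<^bsub>B\<^esub> h x"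
    if that: "x \<in> carrier A" "y \<in> carrier A" for x y
  proof -
    have "(x \<leadsto>\<^bsub>A\<^esub> y) \<leadsto>\<^bsub>A\<^esub> y = (y \<leadsto>\<^bsub>A\<^esub> x) \<leadsto>\<^bsub>A\<^esub> x" using ax that by blast
    then show ?thesis using that by (simp only: to_A)
  qed
  ultimately show ?thesis
    unfolding mv_algebra_alt * by (intro conjI ballI) (simp_all only: simp_thms)
qed

lemma iso_chain: "mv_chain A \<Longrightarrow> mv_chain B"
proof -
  have "mv_le B (h x) (h y)" if "mv_le A x y" "x \<in> carrier A" "y \<in> carrier A" for x y
    using that unfolding mv_le_def by (metis iso_simps(2,5))
  then show "mv_chain A \<Longrightarrow> mv_chain B"
    using iso_algebra unfolding mv_chain_def iso_carrier(1) by blast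
qed

lemma iso_congruence:
  assumes "\<theta> \<in> congruences (carrier B) {neg B} {oplus B}"
  shows "{(x, y) \<in> carrier A \<times> carrier A. (h x, h y) \<in> \<theta>}
    \<in> congruences (carrier A) {neg A} {oplus A}"
proof -
  have "refl_on (carrier B) \<theta>" "sym \<theta>" "trans \<theta>"
    and n: "\<And>x y. (x, y) \<in> \<theta> \<Longrightarrow> (\<sim>\<^bsub>B\<^esub> x, \<sim>\<^bsub>B\<^esub> y) \<in> \<theta>"
    and p: "\<And>x x' y y'. (x, x') \<in> \<theta> \<Longrightarrow> (y, y') \<in> \<theta> \<Longrightarrow> (x \<oplus>\<^bsub>B\<^esub> y, x' \<oplus>\<^bsub>B\<^esub> y') \<in> \<theta>"
    using assms unfolding congruences_def equiv_def by blast+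
  let ?\<phi> = "{(x, y) \<in> carrier A \<times> carrier A. (h x, h y) \<in> \<theta>}"
  have "?\<phi> \<subseteq> carrier A \<times> carrier A" by blast
  moreover have "refl_on (carrier A) ?\<phi>"
    using \<open>refl_on (carrier B) \<theta>\<close> by (simp add: refl_on_def iso_carrier(1))
  moreover have "sym ?\<phi>"
    using \<open>sym \<theta>\<close> unfolding sym_def by blast
  moreover have "trans ?\<phi>"
    using \<open>trans \<theta>\<close> unfolding trans_def by blast
  moreover have "(\<sim>\<^bsub>A\<^esub> x, \<sim>\<^bsub>A\<^esub> y) \<in> ?\<phi>" if "(x, y) \<in> ?\<phi>" for x y
    using that n by (simp add: iso_simps(3) A_closed(3))
  moreover have "(x \<oplus>\<^bsub>A\<^esub> y, x' \<oplus>\<^bsub>A\<^esub> y') \<in> ?\<phi>" if "(x, x') \<in> ?\<phi>" "(y, y') \<in> ?\<phi>" for x x' y y'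
    using that p by (simp add: iso_simps(4) A_closed(4))
  ultimately show ?thesis
    unfolding congruences_def equiv_def by blast
qed

lemma iso_congruence':
  assumes "\<theta> \<in> congruences (carrier A) {neg A} {oplus A}"
  shows "map_prod h h ` \<theta> \<in> congruences (carrier B) {neg B} {oplus B}"
proof -
  have sub: "\<theta> \<subseteq> carrier A \<times> carrier A" and "refl_on (carrier A) \<theta>" and "sym \<theta>"
    and tr: "trans \<theta>"
    and n: "\<And>x y. (x, y) \<in> \<theta> \<Longrightarrow> (\<sim>\<^bsub>A\<^esub> x, \<sim>\<^bsub>A\<^esub> y) \<in> \<theta>"
    and p: "\<And>x x' y y'. (x, x') \<in> \<theta> \<Longrightarrow> (y, y') \<in> \<theta> \<Longrightarrow> (x \<oplus>\<^bsub>A\<^esub> y, x' \<oplus>\<^bsub>A\<^esub> y') \<in> \<theta>"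
    using assms by (auto simp: congruences_def equiv_def)
  have "trans (map_prod h h ` \<theta>)"
  proof (rule transI)
    fix u v w
    assume "(u, v) \<in> map_prod h h ` \<theta>" "(v, w) \<in> map_prod h h ` \<theta>"
    then obtain x y y' z where *: "(x, y) \<in> \<theta>" "(y', z) \<in> \<theta>" "h y = h y'" "u = h x" "w = h z"
      by auto
    moreover have "y \<in> carrier A" "y' \<in> carrier A" using * sub by auto
    with * have "y = y'" using iso_carrier(2) by (auto dest: inj_onD)
    ultimately have "(x, z) \<in> \<theta>" using tr by (auto dest: transD)
    then show "(u, w) \<in> map_prod h h ` \<theta>" using * by force
  qed
  moreover have "(\<sim>\<^bsub>B\<^esub> h x, \<sim>\<^bsub>B\<^esub> h y) \<in> map_prod h h ` \<theta>" if "(x, y) \<in> \<theta>" for x y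
  proof (rule image_eqI)
    have "x \<in> carrier A" "y \<in> carrier A" using sub that by auto
    then show "(\<sim>\<^bsub>B\<^esub> h x, \<sim>\<^bsub>B\<^esub> h y) = map_prod h h (\<sim>\<^bsub>A\<^esub> x, \<sim>\<^bsub>A\<^esub> y)"
      by (simp add: iso_simps(3))
  qed (rule n[OF that])
  moreover have "(h x \<oplus>\<^bsub>B\<^esub> h y, h x' \<oplus>\<^bsub>B\<^esub> h y') \<in> map_prod h h ` \<theta>"
    if "(x, x') \<in> \<theta>" "(y, y') \<in> \<theta>" for x x' y y'
  proof (rule image_eqI)
    have "x \<in> carrier A" "y \<in> carrier A" "x' \<in> carrier A" "y' \<in> carrier A"
      using sub that by auto
    then show "(h x \<oplus>\<^bsub>B\<^esub> h y, h x' \<oplus>\<^bsub>B\<^esub> h y') = map_prod h h (x \<oplus>\<^bsub>A\<^esub> y, x' \<oplus>\<^bsub>A\<^esub> y')"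
      by (simp add: iso_simps(4))
  qed (rule p[OF that])
  moreover have "map_prod h h ` \<theta> \<subseteq> carrier B \<times> carrier B"
    using sub by (auto simp: iso_carrier(1))
  moreover have "refl_on (carrier B) (map_prod h h ` \<theta>)"
    using \<open>refl_on (carrier A) \<theta>\<close> by (force simp: refl_on_def iso_carrier(1))
  moreover have "sym (map_prod h h ` \<theta>)"
    using \<open>sym \<theta>\<close> by (force simp: sym_def)
  ultimately show ?thesis
    by (auto simp: congruences_def equiv_def)
qed

lemma iso_subdirectly_irreducible:
  assumes "mv_subdirectly_irreducible A"
  shows "mv_subdirectly_irreducible B"
proof -
  let ?CA = "congruences (carrier A) {neg A} {oplus A}"
  let ?CB = "congruences (carrier B) {neg B} {oplus B}"
  obtain x y \<mu> where xy: "x \<in> carrier A" "y \<in> carrier A" "x \<noteq> y"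
    and \<mu>: "\<mu> \<in> ?CA" "\<mu> \<noteq> Id_on (carrier A)"
    and least: "\<And>\<theta>. \<theta> \<in> ?CA \<Longrightarrow> \<theta> \<noteq> Id_on (carrier A) \<Longrightarrow> \<mu> \<subseteq> \<theta>"
    using assms
    unfolding mv_subdirectly_irreducible_def subdirectly_irreducible_def nontrivial_def by blast
  have sub: "\<theta> \<subseteq> carrier A \<times> carrier A" "Id_on (carrier A) \<subseteq> \<theta>" if "\<theta> \<in> ?CA" for \<theta>
    using that by (auto simp: congruences_def equiv_def refl_on_def)
  have subB: "\<theta> \<subseteq> carrier B \<times> carrier B" "Id_on (carrier B) \<subseteq> \<theta>" if "\<theta> \<in> ?CB" for \<theta>
    using that by (auto simp: congruences_def equiv_def refl_on_def)
  obtain u v where uv: "(u, v) \<in> \<mu>" "u \<noteq> v" using sub[OF \<mu>(1)] \<mu>(2) by auto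
  have "h u \<noteq> h v" using uv sub[OF \<mu>(1)] iso_carrier(2) by (auto dest: inj_onD)
  then have "(h u, h v) \<in> map_prod h h ` \<mu>" "(h u, h v) \<notin> Id_on (carrier B)"
    using uv(1) by force+
  then have ne: "map_prod h h ` \<mu> \<noteq> Id_on (carrier B)" by metis
  have "map_prod h h ` \<mu> \<subseteq> \<theta>" if \<theta>: "\<theta> \<in> ?CB" "\<theta> \<noteq> Id_on (carrier B)" for \<theta>
  proof -
    let ?\<phi> = "{(x, y) \<in> carrier A \<times> carrier A. (h x, h y) \<in> \<theta>}"
    obtain c d where "(c, d) \<in> \<theta>" "c \<noteq> d" using subB[OF \<theta>(1)] \<theta>(2) by auto
    moreover from this obtain a b where "a \<in> carrier A" "b \<in> carrier A" "c = h a" "d = h b"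
      using subB[OF \<theta>(1)] unfolding iso_carrier(1) by auto
    ultimately have "(a, b) \<in> ?\<phi>" "(a, b) \<notin> Id_on (carrier A)" by auto
    then have "?\<phi> \<noteq> Id_on (carrier A)" by metis
    then have "\<mu> \<subseteq> ?\<phi>" using least iso_congruence[OF \<theta>(1)] by blast
    then show ?thesis by auto
  qed
  moreover have "nontrivial (carrier B)"
    using xy iso_carrier unfolding nontrivial_def by (metis imageI inj_onD)
  ultimately show ?thesis
    using iso_congruence'[OF \<mu>(1)] ne iso_algebra
    unfolding mv_subdirectly_irreducible_def subdirectly_irreducible_def
    by (intro conjI bexI[of _ "map_prod h h ` \<mu>"]) auto
qed

end

lemma mv_transport:
  fixes C :: "'c mv_algebra" and g :: "'c \<Rightarrow> 'a"
  assumes "mv_algebra C" "inj_on g (carrier C)"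
  obtains E :: "'a mv_algebra" where "mv_isomorphism C E g"
proof
  define f where "f = inv_into (carrier C) g"
  have [simp]: "f (g x) = x" if "x \<in> carrier C" for x
    using assms(2) that by (simp add: f_def)
  show "mv_isomorphism C \<lparr>carrier = g ` carrier C, oplus = (\<lambda>x y. g (f x \<oplus>\<^bsub>C\<^esub> f y)),
      neg = (\<lambda>x. g (\<sim>\<^bsub>C\<^esub> f x)), mv_zero = g \<zero>\<^bsub>C\<^esub>\<rparr> g"
    using assms by (auto simp: mv_isomorphism_def mv_hom_def bij_betw_def)
qed

lemma mv_prod_simps [simp]:
  "carrier (mv_prod B C) = carrier B \<times> carrier C"
  "oplus (mv_prod B C) (b, c) (b', c') = (b \<oplus>\<^bsub>B\<^esub> b', c \<oplus>\<^bsub>C\<^esub> c')"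
  "neg (mv_prod B C) (b, c) = (\<sim>\<^bsub>B\<^esub> b, \<sim>\<^bsub>C\<^esub> c)"
  "mv_zero (mv_prod B C) = (\<zero>\<^bsub>B\<^esub>, \<zero>\<^bsub>C\<^esub>)"
  by (simp_all add: mv_prod_def)

lemma mv_prod_closed_iff:
  "smmv_subalgebra S (mv_prod (C\<lparr>carrier := B\<rparr>) C) diag_op \<longleftrightarrow>
    S \<subseteq> B \<times> carrier C \<and> (\<zero>\<^bsub>C\<^esub>, \<zero>\<^bsub>C\<^esub>) \<in> S \<and>
    (\<forall>x y. (x, y) \<in> S \<longrightarrow> (\<sim>\<^bsub>C\<^esub> x, \<sim>\<^bsub>C\<^esub> y) \<in> S) \<and>
    (\<forall>x y x' y'. (x, y) \<in> S \<longrightarrow> (x', y') \<in> S \<longrightarrow> (x \<oplus>\<^bsub>C\<^esub> x', y \<oplus>\<^bsub>C\<^esub> y') \<in> S) \<and>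
    (\<forall>x y. (x, y) \<in> S \<longrightarrow> (x, x) \<in> S)"
proof -
  have *: "(\<forall>p\<in>S. P p) \<longleftrightarrow> (\<forall>x y. (x, y) \<in> S \<longrightarrow> P (x, y))" for P
    by auto
  show ?thesis
    unfolding smmv_subalgebra_def mv_subalgebra_def *
    by (simp add: diag_op_def)
qed

lemma mv_transport_sub:
  fixes A :: "'a mv_algebra" and C :: "'c mv_algebra"
  assumes C: "mv_algebra C" and B: "mv_subalgebra B C"
    and S: "smmv_subalgebra S (mv_prod (C\<lparr>carrier := B\<rparr>) C) diag_op"
    and iso: "smmv_isomorphic A \<tau> ((mv_prod (C\<lparr>carrier := B\<rparr>) C)\<lparr>carrier := S\<rparr>) diag_op"
    and fst: "fst ` S = B" and snd: "snd ` S = carrier C"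
  obtains E :: "'a mv_algebra" and g where "mv_isomorphism C E g" "mv_subalgebra (g ` B) E"
    "smmv_subalgebra (map_prod g g ` S) (mv_prod (E\<lparr>carrier := g ` B\<rparr>) E) diag_op"
    "smmv_isomorphic A \<tau> ((mv_prod (E\<lparr>carrier := g ` B\<rparr>) E)\<lparr>carrier := map_prod g g ` S\<rparr>) diag_op"
proof -
  obtain h where h: "h \<in> mv_hom A ((mv_prod (C\<lparr>carrier := B\<rparr>) C)\<lparr>carrier := S\<rparr>)"
    and bij: "bij_betw h (carrier A) S" and h\<tau>: "\<And>x. x \<in> carrier A \<Longrightarrow> h (\<tau> x) = diag_op (h x)"
    using iso by (auto simp: smmv_isomorphic_def)
  define g where "g = inv_into (carrier A) (snd \<circ> h)"
  have "(snd \<circ> h) ` carrier A = carrier C"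
    using bij snd by (auto simp: bij_betw_def image_comp[symmetric])
  then have inj: "inj_on g (carrier C)"
    unfolding g_def by (metis inj_on_inv_into order_refl)
  obtain E :: "'a mv_algebra" where E: "mv_isomorphism C E g"
    using mv_transport[OF C inj] .
  have BC: "B \<subseteq> carrier C" using B by (simp add: mv_subalgebra_def)
  have SC: "S \<subseteq> carrier C \<times> carrier C" using S BC by (auto simp: smmv_subalgebra_def mv_subalgebra_def)
  note gs = iso_simps[OF E C]
  have sB: "mv_subalgebra (g ` B) E"
    unfolding mv_subalgebra_def
  proof (intro conjI ballI)
    show "g ` B \<subseteq> carrier E" using BC by (auto simp: iso_carrier(1)[OF E C])
    show "\<zero>\<^bsub>E\<^esub> \<in> g ` B" unfolding gs(1)[symmetric] using B by (simp add: mv_subalgebra_def)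
    show "\<sim>\<^bsub>E\<^esub> x \<in> g ` B" if x: "x \<in> g ` B" for x
    proof -
      obtain a where a: "a \<in> B" "x = g a" using x by blast
      then have "\<sim>\<^bsub>E\<^esub> x = g (\<sim>\<^bsub>C\<^esub> a)" using BC by (simp add: gs(3) subset_iff)
      then show ?thesis using a B by (simp add: mv_subalgebra_def)
    qed
    show "x \<oplus>\<^bsub>E\<^esub> y \<in> g ` B" if xy: "x \<in> g ` B" "y \<in> g ` B" for x y
    proof -
      obtain a b where ab: "a \<in> B" "x = g a" "b \<in> B" "y = g b" using xy by blast
      then have "x \<oplus>\<^bsub>E\<^esub> y = g (a \<oplus>\<^bsub>C\<^esub> b)" using BC by (simp add: gs(4) subset_iff)
      then show ?thesis using ab B by (simp add: mv_subalgebra_def)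
    qed
  qed
  have gen: "x \<in> carrier C" "y \<in> carrier C" if "(x, y) \<in> S" for x y
    using SC that by auto
  have gn: "(\<sim>\<^bsub>E\<^esub> g x, \<sim>\<^bsub>E\<^esub> g y) = map_prod g g (\<sim>\<^bsub>C\<^esub> x, \<sim>\<^bsub>C\<^esub> y)" if "(x, y) \<in> S" for x y
    using gen[OF that] by (simp add: gs)
  have gp: "(g x \<oplus>\<^bsub>E\<^esub> g x', g y \<oplus>\<^bsub>E\<^esub> g y') = map_prod g g (x \<oplus>\<^bsub>C\<^esub> x', y \<oplus>\<^bsub>C\<^esub> y')"
    if "(x, y) \<in> S" "(x', y') \<in> S" for x y x' y'
    using gen[OF that(1)] gen[OF that(2)] by (simp add: gs)
  have g0: "(\<zero>\<^bsub>E\<^esub>, \<zero>\<^bsub>E\<^esub>) = map_prod g g (\<zero>\<^bsub>C\<^esub>, \<zero>\<^bsub>C\<^esub>)"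
    by (simp add: gs)
  have Scl: "(\<zero>\<^bsub>C\<^esub>, \<zero>\<^bsub>C\<^esub>) \<in> S" "\<And>x y. (x, y) \<in> S \<Longrightarrow> (\<sim>\<^bsub>C\<^esub> x, \<sim>\<^bsub>C\<^esub> y) \<in> S"
    "\<And>x y x' y'. (x, y) \<in> S \<Longrightarrow> (x', y') \<in> S \<Longrightarrow> (x \<oplus>\<^bsub>C\<^esub> x', y \<oplus>\<^bsub>C\<^esub> y') \<in> S"
    "\<And>x y. (x, y) \<in> S \<Longrightarrow> (x, x) \<in> S"
    using S mv_prod_closed_iff[of S B C] by blast+
  have sS: "smmv_subalgebra (map_prod g g ` S) (mv_prod (E\<lparr>carrier := g ` B\<rparr>) E) diag_op"
    unfolding smmv_subalgebra_def mv_subalgebra_def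
  proof (intro conjI ballI)
    show "map_prod g g ` S \<subseteq> carrier (mv_prod (E\<lparr>carrier := g ` B\<rparr>) E)"
      using S by (auto simp: smmv_subalgebra_def mv_subalgebra_def iso_carrier(1)[OF E C])
    show "\<zero>\<^bsub>mv_prod (E\<lparr>carrier := g ` B\<rparr>) E\<^esub> \<in> map_prod g g ` S"
      using Scl(1) by (simp add: g0 del: map_prod_simp)
    show "\<sim>\<^bsub>mv_prod (E\<lparr>carrier := g ` B\<rparr>) E\<^esub> x \<in> map_prod g g ` S" if x: "x \<in> map_prod g g ` S" for x
    proof -
      obtain a b where "(a, b) \<in> S" "x = (g a, g b)"
        using x by auto
      then show ?thesis using Scl(2) by (simp add: gn del: map_prod_simp)
    qed
    show "x \<oplus>\<^bsub>mv_prod (E\<lparr>carrier := g ` B\<rparr>) E\<^esub> y \<in> map_prod g g ` S"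
      if xy: "x \<in> map_prod g g ` S" "y \<in> map_prod g g ` S" for x y
    proof -
      obtain a b a' b' where "(a, b) \<in> S" "(a', b') \<in> S" "x = (g a, g b)" "y = (g a', g b')"
        using xy by auto
      then show ?thesis using Scl(3) by (simp add: gp del: map_prod_simp)
    qed
    show "diag_op x \<in> map_prod g g ` S" if "x \<in> map_prod g g ` S" for x
      using that Scl(4) by (force simp: diag_op_def)
  qed
  have hS: "h x \<in> S" if "x \<in> carrier A" for x
    using bij that by (auto simp: bij_betw_def)
  have "inj_on (map_prod g g) S"
    using map_prod_inj_on[OF inj inj] SC by (rule inj_on_subset)
  then have "bij_betw (map_prod g g) S (map_prod g g ` S)"
    by (rule inj_on_imp_bij_betw)
  with bij have bij': "bij_betw (map_prod g g \<circ> h) (carrier A) (map_prod g g ` S)"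
    by (rule bij_betw_trans)
  have "map_prod g g \<circ> h \<in> mv_hom A ((mv_prod (E\<lparr>carrier := g ` B\<rparr>) E)\<lparr>carrier := map_prod g g ` S\<rparr>)"
    unfolding mv_hom_def mem_Collect_eq
  proof (intro conjI ballI)
    show "map_prod g g \<circ> h \<in> carrier A \<rightarrow> carrier ((mv_prod (E\<lparr>carrier := g ` B\<rparr>) E)\<lparr>carrier := map_prod g g ` S\<rparr>)"
      using hS by auto
    show "(map_prod g g \<circ> h) \<zero>\<^bsub>A\<^esub> = \<zero>\<^bsub>(mv_prod (E\<lparr>carrier := g ` B\<rparr>) E)\<lparr>carrier := map_prod g g ` S\<rparr>\<^esub>"
      using h by (simp add: mv_hom_def gs)
    fix x assume x: "x \<in> carrier A"
    obtain a b where ab: "h x = (a, b)" "(a, b) \<in> S" using hS[OF x] by (metis surj_pair)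
    then show "(map_prod g g \<circ> h) (\<sim>\<^bsub>A\<^esub> x) = \<sim>\<^bsub>(mv_prod (E\<lparr>carrier := g ` B\<rparr>) E)\<lparr>carrier := map_prod g g ` S\<rparr>\<^esub> (map_prod g g \<circ> h) x"
      using h x gen[OF ab(2)] by (simp add: mv_hom_def gs)
    fix y assume y: "y \<in> carrier A"
    obtain a' b' where ab': "h y = (a', b')" "(a', b') \<in> S" using hS[OF y] by (metis surj_pair)
    then show "(map_prod g g \<circ> h) (x \<oplus>\<^bsub>A\<^esub> y) = (map_prod g g \<circ> h) x \<oplus>\<^bsub>(mv_prod (E\<lparr>carrier := g ` B\<rparr>) E)\<lparr>carrier := map_prod g g ` S\<rparr>\<^esub> (map_prod g g \<circ> h) y"
      using h x y ab gen[OF ab(2)] gen[OF ab'(2)] by (simp add: mv_hom_def gs)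
  qed
  then have "smmv_isomorphic A \<tau> ((mv_prod (E\<lparr>carrier := g ` B\<rparr>) E)\<lparr>carrier := map_prod g g ` S\<rparr>) diag_op"
    unfolding smmv_isomorphic_def
    using bij' h\<tau> by (intro bexI[of _ "map_prod g g \<circ> h"]) (auto simp: diag_op_def split: prod.splits)
  with E sB sS that show ?thesis by blast
qed

theorem subdiagonal_any_type:
  fixes A :: "'a mv_algebra" and D :: "('c \<times> 'c) mv_algebra"
  assumes "diagonal D \<sigma>" "smmv_subalgebra S D \<sigma>" "smmv_isomorphic A \<tau> (D\<lparr>carrier := S\<rparr>) \<sigma>"
  shows "subdiagonal A \<tau>"
proof -
  obtain B C where C: "mv_chain C" and B: "mv_subalgebra B C"
    and D: "D = mv_prod (C\<lparr>carrier := B\<rparr>) C" and \<sigma>: "\<sigma> = diag_op"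
    using assms(1) by (auto simp: diagonal_def)
  define C' where "C' = C\<lparr>carrier := snd ` S\<rparr>"
  have Scl: "(\<zero>\<^bsub>C\<^esub>, \<zero>\<^bsub>C\<^esub>) \<in> S" "\<And>x y. (x, y) \<in> S \<Longrightarrow> (\<sim>\<^bsub>C\<^esub> x, \<sim>\<^bsub>C\<^esub> y) \<in> S"
    "\<And>x y x' y'. (x, y) \<in> S \<Longrightarrow> (x', y') \<in> S \<Longrightarrow> (x \<oplus>\<^bsub>C\<^esub> x', y \<oplus>\<^bsub>C\<^esub> y') \<in> S"
    "\<And>x y. (x, y) \<in> S \<Longrightarrow> (x, x) \<in> S" "S \<subseteq> B \<times> carrier C"
    using assms(2) mv_prod_closed_iff[of S B C] unfolding D \<sigma> by blast+
  have "mv_subalgebra (snd ` S) C"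
    unfolding mv_subalgebra_def
  proof (intro conjI ballI)
    show "snd ` S \<subseteq> carrier C" using Scl(5) by auto
    show "\<zero>\<^bsub>C\<^esub> \<in> snd ` S" using Scl(1) by force
    show "\<sim>\<^bsub>C\<^esub> x \<in> snd ` S" if "x \<in> snd ` S" for x
      using that Scl(2) by force
    show "x \<oplus>\<^bsub>C\<^esub> y \<in> snd ` S" if "x \<in> snd ` S" "y \<in> snd ` S" for x y
      using that Scl(3) by force
  qed
  then have C': "mv_chain C'" unfolding C'_def by (rule mv_subalgebra_chain[OF C])
  have B': "mv_subalgebra (fst ` S) C'"
    unfolding mv_subalgebra_def
  proof (intro conjI ballI)
    show "fst ` S \<subseteq> carrier C'" using Scl(4) by (force simp: C'_def)
    show "\<zero>\<^bsub>C'\<^esub> \<in> fst ` S" using Scl(1) by (force simp: C'_def)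
    show "\<sim>\<^bsub>C'\<^esub> x \<in> fst ` S" if "x \<in> fst ` S" for x
      using that Scl(2) by (force simp: C'_def)
    show "x \<oplus>\<^bsub>C'\<^esub> y \<in> fst ` S" if "x \<in> fst ` S" "y \<in> fst ` S" for x y
      using that Scl(3) by (force simp: C'_def)
  qed
  have upd: "(mv_prod (C'\<lparr>carrier := fst ` S\<rparr>) C')\<lparr>carrier := S\<rparr> = D\<lparr>carrier := S\<rparr>"
    by (simp add: mv_prod_def C'_def D)
  have S': "smmv_subalgebra S (mv_prod (C'\<lparr>carrier := fst ` S\<rparr>) C') diag_op"
  proof -
    have "S \<subseteq> fst ` S \<times> snd ` S" by force
    then show ?thesis using Scl unfolding mv_prod_closed_iff C'_def by simp
  qed
  obtain E :: "'a mv_algebra" and g where E: "mv_isomorphism C' E g" "mv_subalgebra (g ` fst ` S) E"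
    "smmv_subalgebra (map_prod g g ` S) (mv_prod (E\<lparr>carrier := g ` fst ` S\<rparr>) E) diag_op"
    "smmv_isomorphic A \<tau> ((mv_prod (E\<lparr>carrier := g ` fst ` S\<rparr>) E)\<lparr>carrier := map_prod g g ` S\<rparr>) diag_op"
  proof (rule mv_transport_sub[OF _ B' S', of A \<tau>])
    show "mv_algebra C'" using C' by (simp add: mv_chain_def)
    show "smmv_isomorphic A \<tau> ((mv_prod (C'\<lparr>carrier := fst ` S\<rparr>) C')\<lparr>carrier := S\<rparr>) diag_op"
      using assms(3) by (simp only: upd \<sigma>)
    show "snd ` S = carrier C'" by (simp add: C'_def)
  qed simp_all
  have "mv_chain E" using iso_chain[OF E(1)] C' by (auto simp: mv_chain_def)
  then have "diagonal (mv_prod (E\<lparr>carrier := g ` fst ` S\<rparr>) E) diag_op"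
    using E(2) mv_subalgebra_chain unfolding diagonal_def by blast
  then show ?thesis using E unfolding subdiagonal_def by blast
qed

theorem type_D_any_type:
  fixes A :: "'a mv_algebra" and C :: "'c mv_algebra"
  assumes C: "mv_subdirectly_irreducible C" and B: "mv_subalgebra B C"
    and iso: "smmv_isomorphic A \<tau> (mv_prod (C\<lparr>carrier := B\<rparr>) C) diag_op"
  shows "type_D A \<tau>"
proof -
  let ?S = "B \<times> carrier C"
  have mvC: "mv_algebra C" using C by (simp add: mv_subdirectly_irreducible_def)
  have upd: "(mv_prod (X\<lparr>carrier := Y\<rparr>) X)\<lparr>carrier := Y \<times> carrier X\<rparr> = mv_prod (X\<lparr>carrier := Y\<rparr>) X"
    for X :: "'x mv_algebra" and Y by (simp add: mv_prod_def)
  have ne: "B \<noteq> {}" "carrier C \<noteq> {}" "B \<subseteq> carrier C" using B by (auto simp: mv_subalgebra_def)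
  have S: "smmv_subalgebra ?S (mv_prod (C\<lparr>carrier := B\<rparr>) C) diag_op"
    using B mvC by (auto simp: smmv_subalgebra_def mv_subalgebra_def mv_algebra_alt diag_op_def)
  obtain E :: "'a mv_algebra" and g where E: "mv_isomorphism C E g" "mv_subalgebra (g ` B) E"
    "smmv_isomorphic A \<tau> ((mv_prod (E\<lparr>carrier := g ` B\<rparr>) E)\<lparr>carrier := map_prod g g ` ?S\<rparr>) diag_op"
  proof (rule mv_transport_sub[OF mvC B S, of A \<tau>])
    show "smmv_isomorphic A \<tau> ((mv_prod (C\<lparr>carrier := B\<rparr>) C)\<lparr>carrier := ?S\<rparr>) diag_op"
      using iso by (simp only: upd)
    show "fst ` ?S = B" "snd ` ?S = carrier C" using ne by (simp_all add: fst_image_times snd_image_times)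
  qed simp_all
  have "map_prod g g ` ?S = g ` B \<times> carrier E"
    unfolding iso_carrier(1)[OF E(1) mvC] by (rule map_prod_surj_on; rule refl)
  then have "smmv_isomorphic A \<tau> (mv_prod (E\<lparr>carrier := g ` B\<rparr>) E) diag_op"
    using E(3) by (simp add: upd)
  then show ?thesis
    using E(2) iso_subdirectly_irreducible[OF E(1) mvC C] unfolding type_D_def by blast
qed

end

theory Submission
  imports Defs
begin

text \<open>Congruences of \<open>(A, \<tau>)\<close> correspond to the filters that are closed under \<open>\<tau>\<close>, called
  \<open>\<tau>\<close>-filters below. Subdirect irreducibility therefore says that some \<open>m \<noteq> 1\<close> lies in every
  nontrivial \<open>\<tau>\<close>-filter; the same holds for MV-algebras with all filters, and for the hoop on
  \<open>F = F_tau A \<tau>\<close> with the filters contained in \<open>F\<close>, which are automatically \<open>\<tau>\<close>-filters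
  (\<open>subdirectly_irreducible_iff_filter\<close>).

  Let \<open>(A, \<tau>)\<close> be subdirectly irreducible. If \<open>F\<close> is trivial, then \<open>\<tau>\<close> is the identity and \<open>A\<close> is of
  type I. Otherwise two elements \<open>x\<close>, \<open>y\<close> different from \<open>1\<close> cannot be orthogonal, together with
  their images under \<open>\<tau>\<close>, in the sense of having join \<open>1\<close>, for they would generate \<open>\<tau>\<close>-filters with
  trivial intersection (\<open>subdirectly_irreducible_orthogonal\<close>). This gives at once the disjunction
  property, that \<open>\<tau>(A)\<close> is a chain, and that \<open>F\<close> is a chain. Let \<open>P\<close> consist of the elements that
  have join \<open>1\<close> with all elements of \<open>F\<close>. Since \<open>F\<close> is a chain, \<open>P\<close> is a prime filter, so \<open>A / P\<close> is a
  chain; \<open>P\<close> meets \<open>F\<close> trivially, and it meets \<open>\<tau>(A)\<close> trivially by the disjunction property. Hence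
  \<open>x \<mapsto> (\<tau> x / P, x / P)\<close> embeds \<open>(A, \<tau>)\<close> into a diagonal algebra, and \<open>A\<close> is of type L if it is
  local. If \<open>A\<close> is not local, then no proper filter contains both of the prime filters \<open>F\<close> and \<open>P\<close>
  (\<open>not_local_comaximal\<close>), the embedding is onto by the Chinese remainder theorem
  (\<open>embedding_surj\<close>), and \<open>A\<close> is of type D.

  Conversely, in type L a \<open>\<tau>\<close>-filter that meets \<open>F\<close> trivially is fixed elementwise by \<open>\<tau>\<close>, so it is
  trivial by the disjunction property; the least nontrivial filter inside \<open>F\<close> is then the least
  nontrivial \<open>\<tau>\<close>-filter. In type D the least nontrivial filter of the second factor plays this
  part. The types exclude each other because \<open>\<tau>\<close> is the identity in type I only, and because an
  algebra of type D contains an element \<open>e\<close> such that \<open>e\<close> and \<open>\<sim> e\<close> lie in proper filters, which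
  is impossible in a local algebra.\<close>

section \<open>Arithmetic of MV-algebras\<close>

context mv_algebra
begin

abbreviation le (infix \<open>\<preceq>\<close> 50) where
  "x \<preceq> y \<equiv> mv_le A x y"

declare neg_closed [simp] neg_neg [simp]

lemma mv_axioms:
  shows zero_closed [simp]: "\<zero> \<in> carrier A"
    and oplus_closed [simp]: "x \<in> carrier A \<Longrightarrow> y \<in> carrier A \<Longrightarrow> x \<oplus> y \<in> carrier A"
    and oplus_assoc: "x \<in> carrier A \<Longrightarrow> y \<in> carrier A \<Longrightarrow> z \<in> carrier A \<Longrightarrow>
      x \<oplus> y \<oplus> z = x \<oplus> (y \<oplus> z)"
    and oplus_commute: "x \<in> carrier A \<Longrightarrow> y \<in> carrier A \<Longrightarrow> x \<oplus> y = y \<oplus> x"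
    and zero_oplus [simp]: "x \<in> carrier A \<Longrightarrow> \<zero> \<oplus> x = x"
    and oplus_zero [simp]: "x \<in> carrier A \<Longrightarrow> x \<oplus> \<zero> = x"
  using mv_algebra_axioms unfolding mv_algebra_alt by blast+

lemma one_closed [simp]: "mv_one A \<in> carrier A"
  by (simp add: mv_one_def)

lemma imp_closed [simp]: "x \<in> carrier A \<Longrightarrow> y \<in> carrier A \<Longrightarrow> x \<leadsto> y \<in> carrier A"
  by (simp add: mv_imp_def)

lemma odot_closed [simp]: "x \<in> carrier A \<Longrightarrow> y \<in> carrier A \<Longrightarrow> x \<odot> y \<in> carrier A"
  by (simp add: mv_odot_def)

lemma join_closed [simp]: "x \<in> carrier A \<Longrightarrow> y \<in> carrier A \<Longrightarrow> x \<curlyvee> y \<in> carrier A"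
  by (simp add: mv_join_def)

lemma neg_one: "\<sim> mv_one A = \<zero>"
  by (simp add: mv_one_def)

lemma neg_as_imp: "x \<in> carrier A \<Longrightarrow> \<sim> x = x \<leadsto> \<zero>"
  by (simp add: mv_imp_def)

lemma oplus_as_imp: "x \<in> carrier A \<Longrightarrow> x \<oplus> y = \<sim> x \<leadsto> y"
  by (simp add: mv_imp_def)

lemma imp_one [simp]: "x \<in> carrier A \<Longrightarrow> x \<leadsto> mv_one A = mv_one A"
  by (simp add: mv_imp_def oplus_one)

lemma one_imp [simp]: "x \<in> carrier A \<Longrightarrow> mv_one A \<leadsto> x = x"
  by (simp add: mv_imp_def neg_one)

lemma imp_self [simp]: "x \<in> carrier A \<Longrightarrow> x \<leadsto> x = mv_one A"
  using imp_imp[of x "mv_one A"] by simp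

lemma zero_imp [simp]: "x \<in> carrier A \<Longrightarrow> \<zero> \<leadsto> x = mv_one A"
  using oplus_commute[of "\<sim> \<zero>" x] by (simp add: mv_imp_def oplus_one flip: mv_one_def)

lemma imp_exchange:
  "x \<in> carrier A \<Longrightarrow> y \<in> carrier A \<Longrightarrow> z \<in> carrier A \<Longrightarrow> x \<leadsto> y \<leadsto> z = y \<leadsto> x \<leadsto> z"
  unfolding mv_imp_def by (metis neg_closed oplus_assoc oplus_commute)

lemma odot_imp:
  "x \<in> carrier A \<Longrightarrow> y \<in> carrier A \<Longrightarrow> z \<in> carrier A \<Longrightarrow> (x \<odot> y) \<leadsto> z = x \<leadsto> y \<leadsto> z"
  by (simp add: mv_imp_def mv_odot_def oplus_assoc)

lemma odot_commute: "x \<in> carrier A \<Longrightarrow> y \<in> carrier A \<Longrightarrow> x \<odot> y = y \<odot> x"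
  by (simp add: mv_odot_def oplus_commute)

lemma odot_one [simp]: "x \<in> carrier A \<Longrightarrow> x \<odot> mv_one A = x"
  by (simp add: mv_odot_def neg_one)

lemma odot_zero [simp]: "x \<in> carrier A \<Longrightarrow> x \<odot> \<zero> = \<zero>"
  using oplus_one[of "\<sim> x"] neg_one by (simp add: mv_odot_def flip: mv_one_def)

lemma divisibility:
  "x \<in> carrier A \<Longrightarrow> y \<in> carrier A \<Longrightarrow> x \<odot> (x \<leadsto> y) = y \<odot> (y \<leadsto> x)"
  using imp_imp[of "\<sim> y" "\<sim> x"]
  by (simp add: mv_odot_def mv_imp_def oplus_commute)

lemma le_refl [simp]: "x \<in> carrier A \<Longrightarrow> x \<preceq> x"
  by (simp add: mv_le_def)

lemma le_antisym:
  "x \<in> carrier A \<Longrightarrow> y \<in> carrier A \<Longrightarrow> x \<preceq> y \<Longrightarrow> y \<preceq> x \<Longrightarrow> x = y"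
  using imp_imp[of x y] by (simp add: mv_le_def)

lemma le_imp_weaken: "x \<in> carrier A \<Longrightarrow> y \<in> carrier A \<Longrightarrow> x \<preceq> y \<leadsto> x"
  using imp_exchange[of x y x] by (simp add: mv_le_def)

text \<open>After an exchange the right side contains the join of \<open>y\<close> and \<open>z\<close>; rewriting it as
  \<open>(z \<leadsto> y) \<leadsto> y\<close> brings \<open>x \<leadsto> y\<close> to the end of a chain of implications.\<close>

lemma imp_suffix:
  assumes "x \<in> carrier A" "y \<in> carrier A" "z \<in> carrier A"
  shows "x \<leadsto> y \<preceq> (y \<leadsto> z) \<leadsto> (x \<leadsto> z)"
proof -
  have "(y \<leadsto> z) \<leadsto> (x \<leadsto> z) = x \<leadsto> ((y \<leadsto> z) \<leadsto> z)"
    using assms by (simp add: imp_exchange)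
  also have "\<dots> = x \<leadsto> ((z \<leadsto> y) \<leadsto> y)"
    using assms by (simp add: imp_imp)
  also have "\<dots> = (z \<leadsto> y) \<leadsto> (x \<leadsto> y)"
    using assms by (simp add: imp_exchange)
  finally show ?thesis
    using assms by (simp add: le_imp_weaken)
qed

lemma le_trans:
  assumes "x \<in> carrier A" "y \<in> carrier A" "z \<in> carrier A" "x \<preceq> y" "y \<preceq> z"
  shows "x \<preceq> z"
  using imp_suffix[of x y z] assms by (simp add: mv_le_def)

lemma imp_prefix:
  assumes "x \<in> carrier A" "y \<in> carrier A" "z \<in> carrier A"
  shows "y \<leadsto> z \<preceq> (x \<leadsto> y) \<leadsto> (x \<leadsto> z)"
  using imp_suffix[of x y z] assms imp_exchange[of "x \<leadsto> y" "y \<leadsto> z" "x \<leadsto> z"]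
  by (simp add: mv_le_def)

lemma imp_antimono:
  assumes "x \<in> carrier A" "y \<in> carrier A" "z \<in> carrier A" "x \<preceq> y"
  shows "y \<leadsto> z \<preceq> x \<leadsto> z"
  using imp_suffix[of x y z] assms by (simp add: mv_le_def)

lemma imp_mono:
  assumes "x \<in> carrier A" "y \<in> carrier A" "z \<in> carrier A" "y \<preceq> z"
  shows "x \<leadsto> y \<preceq> x \<leadsto> z"
  using imp_prefix[of x y z] assms by (simp add: mv_le_def)

lemma le_odot_imp:
  assumes "x \<in> carrier A" "y \<in> carrier A"
  shows "x \<preceq> y \<leadsto> (x \<odot> y)"
  using assms odot_imp[of x y "x \<odot> y"] by (simp add: mv_le_def)

lemma join_commute: "x \<in> carrier A \<Longrightarrow> y \<in> carrier A \<Longrightarrow> x \<curlyvee> y = y \<curlyvee> x"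
  by (simp add: mv_join_def imp_imp)

lemma join_one [simp]: "x \<in> carrier A \<Longrightarrow> x \<curlyvee> mv_one A = mv_one A"
  by (simp add: mv_join_def)

lemma one_join [simp]: "x \<in> carrier A \<Longrightarrow> mv_one A \<curlyvee> x = mv_one A"
  by (simp add: mv_join_def)

lemma join_self [simp]: "x \<in> carrier A \<Longrightarrow> x \<curlyvee> x = x"
  by (simp add: mv_join_def)

lemma zero_join [simp]: "x \<in> carrier A \<Longrightarrow> \<zero> \<curlyvee> x = x"
  by (simp add: mv_join_def)

lemma join_upper2: "x \<in> carrier A \<Longrightarrow> y \<in> carrier A \<Longrightarrow> y \<preceq> x \<curlyvee> y"
  by (simp add: mv_join_def le_imp_weaken)

lemma join_upper1: "x \<in> carrier A \<Longrightarrow> y \<in> carrier A \<Longrightarrow> x \<preceq> x \<curlyvee> y"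
  using join_upper2[of y x] by (simp add: join_commute)

lemma join_least:
  assumes "x \<in> carrier A" "y \<in> carrier A" "z \<in> carrier A" "x \<preceq> z" "y \<preceq> z"
  shows "x \<curlyvee> y \<preceq> z"
proof -
  have "(x \<leadsto> y) \<leadsto> y \<preceq> (z \<leadsto> y) \<leadsto> y"
    using assms by (intro imp_antimono) simp_all
  also have "(z \<leadsto> y) \<leadsto> y = z"
    using assms imp_imp[of z y] by (simp add: mv_le_def)
  finally show ?thesis
    by (simp add: mv_join_def)
qed

lemma le_joinI2:
  assumes "x \<in> carrier A" "y \<in> carrier A" "z \<in> carrier A" "x \<preceq> z"
  shows "x \<preceq> y \<curlyvee> z"
  using assms le_trans[OF _ _ _ _ join_upper2[of y z]] by simp

text \<open>Both sides are \<open>w \<leadsto> x\<close> with \<open>w\<close> the meet of \<open>y\<close> and \<open>u\<close>, which is \<open>y \<odot> (y \<leadsto> u)\<close> by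
  divisibility.\<close>

lemma imp_imp_meet:
  assumes "x \<in> carrier A" "y \<in> carrier A" "u \<in> carrier A"
  shows "(y \<leadsto> u) \<leadsto> (y \<leadsto> x) = (u \<leadsto> y) \<leadsto> (u \<leadsto> x)"
proof -
  have "(y \<leadsto> u) \<leadsto> (y \<leadsto> x) = (y \<odot> (y \<leadsto> u)) \<leadsto> x"
    using assms by (simp add: odot_imp imp_exchange)
  also have "\<dots> = (u \<odot> (u \<leadsto> y)) \<leadsto> x"
    using assms by (simp add: divisibility)
  also have "\<dots> = (u \<leadsto> y) \<leadsto> (u \<leadsto> x)"
    using assms by (simp add: odot_imp imp_exchange)
  finally show ?thesis .
qed

text \<open>With \<open>u = (x \<leadsto> y) \<leadsto> x\<close>, exchanging premises turns the join into an implication that is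
  \<open>1\<close> because \<open>x \<preceq> u\<close>.\<close>

lemma prelinearity:
  assumes x: "x \<in> carrier A" and y: "y \<in> carrier A"
  shows "(x \<leadsto> y) \<curlyvee> (y \<leadsto> x) = mv_one A"
proof -
  define p where "p = x \<leadsto> y"
  define u where "u = p \<leadsto> x"
  have [simp]: "p \<in> carrier A" "u \<in> carrier A"
    using x y by (simp_all add: p_def u_def)
  have "x \<preceq> u"
    using x by (simp add: u_def le_imp_weaken)
  then have "x \<leadsto> (y \<curlyvee> u) = mv_one A"
    using x y by (simp add: le_joinI2 flip: mv_le_def)
  moreover have "p \<curlyvee> (y \<leadsto> x) = (y \<leadsto> u) \<leadsto> (y \<leadsto> x)"
    using x y by (simp add: mv_join_def u_def imp_exchange)
  moreover have "\<dots> = (u \<leadsto> y) \<leadsto> (u \<leadsto> x)"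
    using x y by (simp add: imp_imp_meet)
  moreover have "u \<leadsto> x = (x \<leadsto> p) \<leadsto> p"
    using x by (simp add: u_def imp_imp)
  moreover have "(u \<leadsto> y) \<leadsto> ((x \<leadsto> p) \<leadsto> p) = (x \<leadsto> p) \<leadsto> ((u \<leadsto> y) \<leadsto> p)"
    using x y by (simp add: imp_exchange)
  moreover have "(u \<leadsto> y) \<leadsto> p = x \<leadsto> (u \<curlyvee> y)"
    using x y by (simp add: p_def mv_join_def imp_exchange)
  ultimately show ?thesis
    using x y by (simp add: join_commute flip: p_def)
qed

text \<open>This is what makes every set \<open>{z. z \<curlyvee> p \<in> N}\<close>, for a filter \<open>N\<close>, again a filter; it replaces the
  computations with powers of elements that are customary for generated filters.\<close>

lemma imp_join_le:
  assumes "a \<in> carrier A" "b \<in> carrier A" "p \<in> carrier A"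
  shows "(a \<leadsto> b) \<curlyvee> p \<preceq> (a \<curlyvee> p) \<leadsto> (b \<curlyvee> p)"
proof (rule join_least)
  have "(b \<leadsto> p) \<leadsto> (a \<leadsto> p) \<preceq> ((a \<leadsto> p) \<leadsto> p) \<leadsto> ((b \<leadsto> p) \<leadsto> p)"
    using assms by (intro imp_suffix) simp_all
  then show "a \<leadsto> b \<preceq> (a \<curlyvee> p) \<leadsto> (b \<curlyvee> p)"
    using assms le_trans[OF _ _ _ imp_suffix[of a b p]] by (simp add: mv_join_def)
  have "b \<curlyvee> p \<preceq> (a \<curlyvee> p) \<leadsto> (b \<curlyvee> p)"
    using assms by (simp add: le_imp_weaken)
  then show "p \<preceq> (a \<curlyvee> p) \<leadsto> (b \<curlyvee> p)"
    using assms le_trans[OF _ _ _ join_upper2[of b p]] by simp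
qed (use assms in simp_all)

section \<open>Filters\<close>

lemma filter_subset: "mv_filter A F \<Longrightarrow> x \<in> F \<Longrightarrow> x \<in> carrier A"
  by (auto simp: mv_filter_def)

lemma filter_one [simp]: "mv_filter A F \<Longrightarrow> mv_one A \<in> F"
  by (simp add: mv_filter_def)

lemma filter_mp: "mv_filter A F \<Longrightarrow> a \<in> F \<Longrightarrow> a \<leadsto> b \<in> F \<Longrightarrow> b \<in> carrier A \<Longrightarrow> b \<in> F"
  unfolding mv_filter_def by blast

lemma filter_up: "mv_filter A F \<Longrightarrow> a \<in> F \<Longrightarrow> a \<preceq> b \<Longrightarrow> b \<in> carrier A \<Longrightarrow> b \<in> F"
  using filter_mp[of F a b] by (simp add: mv_le_def)

lemma filter_odot:
  assumes "mv_filter A F" "a \<in> F" "b \<in> F"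
  shows "a \<odot> b \<in> F"
proof -
  have ab: "a \<in> carrier A" "b \<in> carrier A"
    using assms filter_subset by blast+
  then have "b \<leadsto> (a \<odot> b) \<in> F"
    using filter_up[OF assms(1,2) le_odot_imp] by simp
  then show ?thesis
    using filter_mp[OF assms(1,3)] ab by simp
qed

lemma filter_imp:
  "mv_filter A F \<Longrightarrow> b \<in> F \<Longrightarrow> a \<in> carrier A \<Longrightarrow> a \<leadsto> b \<in> F"
  by (meson filter_subset filter_up imp_closed le_imp_weaken)

lemma filter_join:
  "mv_filter A F \<Longrightarrow> a \<in> F \<Longrightarrow> b \<in> carrier A \<Longrightarrow> a \<curlyvee> b \<in> F"
  "mv_filter A F \<Longrightarrow> a \<in> F \<Longrightarrow> b \<in> carrier A \<Longrightarrow> b \<curlyvee> a \<in> F"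
  by (meson filter_subset filter_up join_closed join_upper1 join_upper2)+

lemma filterI:
  assumes "F \<subseteq> carrier A" "mv_one A \<in> F"
    and "\<And>a b. a \<in> F \<Longrightarrow> b \<in> carrier A \<Longrightarrow> a \<leadsto> b \<in> F \<Longrightarrow> b \<in> F"
  shows "mv_filter A F"
  using assms unfolding mv_filter_def by blast

lemma filter_carrier [simp]: "mv_filter A (carrier A)"
  by (rule filterI) simp_all

lemma filter_singleton [simp]: "mv_filter A {mv_one A}"
  by (rule filterI) simp_all

lemma filter_Int: "mv_filter A F \<Longrightarrow> mv_filter A G \<Longrightarrow> mv_filter A (F \<inter> G)"
  unfolding mv_filter_def by blast

lemma filter_INT:
  assumes "I \<noteq> {}" "\<And>i. i \<in> I \<Longrightarrow> mv_filter A (F i)"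
  shows "mv_filter A (\<Inter>i\<in>I. F i)"
  using assms unfolding mv_filter_def by blast

lemma filter_eq_carrier: "mv_filter A F \<Longrightarrow> \<zero> \<in> F \<Longrightarrow> F = carrier A"
  using filter_up[of F "\<zero>"] filter_subset[of F] by (auto simp: mv_le_def)

lemma filter_residual:
  assumes N: "mv_filter A N" and p: "p \<in> carrier A"
  shows "mv_filter A {z \<in> carrier A. z \<curlyvee> p \<in> N}"
proof (rule filterI)
  fix a b
  assume a: "a \<in> {z \<in> carrier A. z \<curlyvee> p \<in> N}" and b: "b \<in> carrier A"
    and ab: "a \<leadsto> b \<in> {z \<in> carrier A. z \<curlyvee> p \<in> N}"
  have "(a \<curlyvee> p) \<leadsto> (b \<curlyvee> p) \<in> N"
    using filter_up[OF N _ imp_join_le[of a b p]] a b ab p by simp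
  then show "b \<in> {z \<in> carrier A. z \<curlyvee> p \<in> N}"
    using filter_mp[OF N, of "a \<curlyvee> p"] a b p by simp
qed (use N p in auto)

lemma filter_polar:
  assumes "X \<subseteq> carrier A"
  shows "mv_filter A {z \<in> carrier A. \<forall>x\<in>X. z \<curlyvee> x = mv_one A}"
proof -
  have "{z \<in> carrier A. \<forall>x\<in>X. z \<curlyvee> x = mv_one A} =
      carrier A \<inter> (\<Inter>x\<in>X. {z \<in> carrier A. z \<curlyvee> x \<in> {mv_one A}})"
    by auto
  moreover have "mv_filter A \<dots>"
  proof (cases "X = {}")
    case False
    then show ?thesis
      using assms by (intro filter_Int filter_INT filter_residual filter_carrier filter_singleton) auto
  qed simp
  ultimately show ?thesis by simp
qed

text \<open>The join of \<open>F\<close> and \<open>G\<close> in the lattice of filters.\<close>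

lemma filter_sup:
  assumes F: "mv_filter A F" and G: "mv_filter A G"
  shows "mv_filter A {z \<in> carrier A. \<exists>x\<in>F. x \<leadsto> z \<in> G}"
proof (rule filterI)
  fix a b
  assume "a \<in> {z \<in> carrier A. \<exists>x\<in>F. x \<leadsto> z \<in> G}" and b: "b \<in> carrier A"
    and "a \<leadsto> b \<in> {z \<in> carrier A. \<exists>x\<in>F. x \<leadsto> z \<in> G}"
  then obtain x y where a: "a \<in> carrier A" and x: "x \<in> F" "x \<leadsto> a \<in> G"
    and y: "y \<in> F" "y \<leadsto> a \<leadsto> b \<in> G"
    by blast
  have [simp]: "x \<in> carrier A" "y \<in> carrier A"
    using x(1) y(1) filter_subset[OF F] by simp_all
  have "a \<leadsto> y \<leadsto> b \<in> G"
    using y(2) a b imp_exchange[of y a b] by simp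
  then have "(x \<leadsto> a) \<leadsto> (x \<leadsto> y \<leadsto> b) \<in> G"
    using filter_up[OF G _ imp_prefix[of x a "y \<leadsto> b"]] a b by simp
  then have "x \<leadsto> y \<leadsto> b \<in> G"
    using filter_mp[OF G x(2)] b by simp
  then have "(x \<odot> y) \<leadsto> b \<in> G"
    using b by (simp add: odot_imp)
  then show "b \<in> {z \<in> carrier A. \<exists>x\<in>F. x \<leadsto> z \<in> G}"
    using b filter_odot[OF F x(1) y(1)] by blast
qed (use F G in \<open>auto intro!: bexI[of _ "mv_one A"]\<close>)

lemma maximal_filter_exists:
  assumes F: "mv_filter A F" "F \<noteq> carrier A"
  obtains N where "maximal_filter A N" "F \<subseteq> N"
proof -
  let ?P = "{G. mv_filter A G \<and> \<zero> \<notin> G \<and> F \<subseteq> G}"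
  have "\<exists>N\<in>?P. \<forall>G\<in>?P. N \<subseteq> G \<longrightarrow> G = N"
  proof (rule subset_Zorn_nonempty)
    show "?P \<noteq> {}"
      using F filter_eq_carrier by blast
  next
    fix \<C> assume ne: "\<C> \<noteq> {}" and "subset.chain ?P \<C>"
    then have sub: "\<C> \<subseteq> ?P" and lin: "\<And>G H. G \<in> \<C> \<Longrightarrow> H \<in> \<C> \<Longrightarrow> G \<subseteq> H \<or> H \<subseteq> G"
      by (auto simp: subset_chain_def)
    have "mv_filter A (\<Union>\<C>)"
    proof (rule filterI)
      fix a b assume "a \<in> \<Union>\<C>" "b \<in> carrier A" "a \<leadsto> b \<in> \<Union>\<C>"
      moreover from this obtain G where "G \<in> \<C>" "a \<in> G" "a \<leadsto> b \<in> G"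
        using lin by blast
      ultimately show "b \<in> \<Union>\<C>"
        using sub filter_mp by blast
    qed (use ne sub filter_one filter_subset in blast)+
    then show "\<Union>\<C> \<in> ?P"
      using ne sub by blast
  qed
  then obtain N where "N \<in> ?P" and *: "\<forall>G\<in>?P. N \<subseteq> G \<longrightarrow> G = N"
    by (rule bexE)
  then have N: "mv_filter A N" "\<zero> \<notin> N" "F \<subseteq> N"
    by simp_all
  have max: "G = N" if "mv_filter A G" "\<zero> \<notin> G" "N \<subseteq> G" for G
    using bspec[OF *, of G] that N(3) by simp
  have "maximal_filter A N"
    unfolding maximal_filter_def
  proof (intro conjI allI impI)
    show "N \<noteq> carrier A"
      using N(2) zero_closed by blast
    show "G = N" if "mv_filter A G \<and> G \<noteq> carrier A \<and> N \<subseteq> G" for G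
      using that max[of G] filter_eq_carrier[of G] by blast
  qed (rule N(1))
  then show ?thesis
    using N(3) by (rule that)
qed

text \<open>The filter \<open>{z. z \<curlyvee> p \<in> N}\<close> contains \<open>N\<close>, so by maximality it is \<open>N\<close> or the whole carrier; in
  the second case it contains \<open>0\<close>, that is, \<open>p \<in> N\<close>.\<close>

lemma maximal_filter_prime:
  assumes "maximal_filter A N" "f \<in> carrier A" "p \<in> carrier A" "f \<curlyvee> p \<in> N"
  shows "f \<in> N \<or> p \<in> N"
proof -
  let ?R = "{z \<in> carrier A. z \<curlyvee> p \<in> N}"
  have N: "mv_filter A N"
    using assms by (simp add: maximal_filter_def)
  have "N \<subseteq> ?R"
    using N assms(3) filter_join(1) filter_subset by blast
  then have "?R = carrier A \<or> ?R = N"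
    using assms(1) filter_residual[OF N assms(3)] by (auto simp: maximal_filter_def)
  then show ?thesis
  proof
    assume "?R = carrier A"
    then have "\<zero> \<curlyvee> p \<in> N"
      using zero_closed by blast
    then show ?thesis
      using assms(3) by simp
  qed (use assms in blast)
qed

lemma filters_above_prime_linear:
  assumes prime: "\<And>a b. a \<in> carrier A \<Longrightarrow> b \<in> carrier A \<Longrightarrow> a \<leadsto> b \<in> F \<or> b \<leadsto> a \<in> F"
    and N: "mv_filter A N" "F \<subseteq> N" and M: "mv_filter A M" "F \<subseteq> M"
  shows "N \<subseteq> M \<or> M \<subseteq> N"
proof (rule ccontr)
  assume "\<not> (N \<subseteq> M \<or> M \<subseteq> N)"
  then obtain a b where ab: "a \<in> N" "a \<notin> M" "b \<in> M" "b \<notin> N" by blast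
  then have cl: "a \<in> carrier A" "b \<in> carrier A"
    using N M filter_subset by blast+
  then consider "a \<leadsto> b \<in> F" | "b \<leadsto> a \<in> F"
    using prime by blast
  then show False
    using ab N M cl by cases (blast dest: filter_mp)+
qed

text \<open>Every maximal filter contains \<open>F\<close> or \<open>P\<close>, as it is prime and \<open>F \<inter> P = {1}\<close>; above each of the two
  the filters form a chain, so that a common proper upper bound of \<open>F\<close> and \<open>P\<close> leaves room for only
  one maximal filter.\<close>

lemma not_local_comaximal:
  assumes F: "mv_filter A F" "\<And>a b. a \<in> carrier A \<Longrightarrow> b \<in> carrier A \<Longrightarrow> a \<leadsto> b \<in> F \<or> b \<leadsto> a \<in> F"
    and P: "mv_filter A P" "\<And>a b. a \<in> carrier A \<Longrightarrow> b \<in> carrier A \<Longrightarrow> a \<leadsto> b \<in> P \<or> b \<leadsto> a \<in> P"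
    and FP: "F \<inter> P = {mv_one A}"
    and nonlocal: "\<not> mv_local A"
  obtains x p where "x \<in> F" "p \<in> P" "p \<preceq> \<sim> x"
proof -
  let ?S = "{z \<in> carrier A. \<exists>x\<in>F. x \<leadsto> z \<in> P}"
  have "\<zero> \<in> ?S"
  proof (rule ccontr)
    assume "\<zero> \<notin> ?S"
    then have "?S \<noteq> carrier A"
      using zero_closed by blast
    then obtain N where N: "maximal_filter A N" "?S \<subseteq> N"
      using maximal_filter_exists[OF filter_sup[OF F(1) P(1)]] by blast
    have "F \<subseteq> ?S"
      using filter_subset[OF F(1)] P(1) by (auto intro!: bexI)
    moreover have "P \<subseteq> ?S"
      using filter_subset[OF P(1)] F(1) by (auto intro!: bexI[of _ "mv_one A"])
    ultimately have sub: "F \<subseteq> N" "P \<subseteq> N"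
      using N by blast+
    have "M = N" if M: "maximal_filter A M" for M
    proof -
      have fM: "mv_filter A M" and fN: "mv_filter A N"
        using M N by (simp_all add: maximal_filter_def)
      have "F \<subseteq> M \<or> P \<subseteq> M"
      proof (rule ccontr)
        assume "\<not> (F \<subseteq> M \<or> P \<subseteq> M)"
        then obtain f p where fp: "f \<in> F" "f \<notin> M" "p \<in> P" "p \<notin> M" by blast
        have cl: "f \<in> carrier A" "p \<in> carrier A"
          using fp F P filter_subset by blast+
        then have "f \<curlyvee> p \<in> F \<inter> P"
          using fp F(1) P(1) by (simp add: filter_join)
        then have "f \<curlyvee> p \<in> M"
          using FP fM by simp
        then show False
          using maximal_filter_prime[OF M cl] fp by blast
      qed
      then have "N \<subseteq> M \<or> M \<subseteq> N"
        using filters_above_prime_linear F(2) P(2) fM fN sub by meson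
      then show "M = N"
        using M N by (auto simp: maximal_filter_def)
    qed
    then have "mv_local A"
      unfolding mv_local_def using N(1) mv_algebra_axioms by blast
    with nonlocal show False by blast
  qed
  then obtain x where "x \<in> F" "x \<leadsto> \<zero> \<in> P" by blast
  then show ?thesis
    using that[of x "x \<leadsto> \<zero>"] filter_subset[OF F(1)] by (simp add: neg_as_imp)
qed

text \<open>The unique maximal filter would extend both \<open>F\<close> and \<open>G\<close>, and so contain \<open>x\<close> and \<open>\<sim> x\<close>.\<close>

lemma local_no_complements:
  assumes "mv_local A"
    and "mv_filter A F" "F \<noteq> carrier A" "x \<in> F"
    and "mv_filter A G" "G \<noteq> carrier A" "\<sim> x \<in> G"
  shows False
proof -
  obtain M where M: "maximal_filter A M" "F \<subseteq> M"
    using maximal_filter_exists[OF assms(2,3)] .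
  obtain N where N: "maximal_filter A N" "G \<subseteq> N"
    using maximal_filter_exists[OF assms(5,6)] .
  have "N = M"
    using assms(1) M(1) N(1) unfolding mv_local_def Ex1_def by metis
  then have "x \<in> M" "\<sim> x \<in> M"
    using M(2) N(2) assms(4,7) by auto
  moreover have "mv_filter A M" "M \<noteq> carrier A"
    using M by (simp_all add: maximal_filter_def)
  moreover from calculation have "\<zero> \<in> M"
    using filter_mp[of M x "\<zero>"] filter_subset[of M x] by (simp add: neg_as_imp)
  ultimately show False
    using filter_eq_carrier by blast
qed

end

section \<open>Subdirect irreducibility through filters\<close>

lemma congruences_iff:
  "\<theta> \<in> congruences X U B \<longleftrightarrow> \<theta> \<subseteq> X \<times> X \<and> (\<forall>x\<in>X. (x, x) \<in> \<theta>) \<and>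
    (\<forall>x y. (x, y) \<in> \<theta> \<longrightarrow> (y, x) \<in> \<theta>) \<and>
    (\<forall>x y z. (x, y) \<in> \<theta> \<longrightarrow> (y, z) \<in> \<theta> \<longrightarrow> (x, z) \<in> \<theta>) \<and>
    (\<forall>f\<in>U. \<forall>x y. (x, y) \<in> \<theta> \<longrightarrow> (f x, f y) \<in> \<theta>) \<and>
    (\<forall>g\<in>B. \<forall>x x'. (x, x') \<in> \<theta> \<longrightarrow> (\<forall>y y'. (y, y') \<in> \<theta> \<longrightarrow> (g x y, g x' y') \<in> \<theta>))"
proof -
  have split: "(\<forall>p\<in>\<theta>. P p) \<longleftrightarrow> (\<forall>x y. (x, y) \<in> \<theta> \<longrightarrow> P (x, y))" for P
    by auto
  show ?thesis
    unfolding congruences_def equiv_def refl_on_def sym_def trans_def mem_Collect_eq split prod.case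
    by (simp only: conj_assoc)
qed

lemma congruencesD:
  assumes "\<theta> \<in> congruences X U B"
  shows "\<theta> \<subseteq> X \<times> X"
    and "x \<in> X \<Longrightarrow> (x, x) \<in> \<theta>"
    and "(x, y) \<in> \<theta> \<Longrightarrow> (y, x) \<in> \<theta>"
    and "(x, y) \<in> \<theta> \<Longrightarrow> (y, z) \<in> \<theta> \<Longrightarrow> (x, z) \<in> \<theta>"
    and "f \<in> U \<Longrightarrow> (x, y) \<in> \<theta> \<Longrightarrow> (f x, f y) \<in> \<theta>"
    and "g \<in> B \<Longrightarrow> (x, x') \<in> \<theta> \<Longrightarrow> (y, y') \<in> \<theta> \<Longrightarrow> (g x y, g x' y') \<in> \<theta>"
  by (insert assms[unfolded congruences_iff], (elim conjE, meson)+)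

lemma congruencesI:
  assumes "\<theta> \<subseteq> X \<times> X"
    and "\<And>x. x \<in> X \<Longrightarrow> (x, x) \<in> \<theta>"
    and "\<And>x y. (x, y) \<in> \<theta> \<Longrightarrow> (y, x) \<in> \<theta>"
    and "\<And>x y z. (x, y) \<in> \<theta> \<Longrightarrow> (y, z) \<in> \<theta> \<Longrightarrow> (x, z) \<in> \<theta>"
    and "\<And>f x y. f \<in> U \<Longrightarrow> (x, y) \<in> \<theta> \<Longrightarrow> (f x, f y) \<in> \<theta>"
    and "\<And>g x x' y y'. g \<in> B \<Longrightarrow> (x, x') \<in> \<theta> \<Longrightarrow> (y, y') \<in> \<theta> \<Longrightarrow> (g x y, g x' y') \<in> \<theta>"
  shows "\<theta> \<in> congruences X U B"
  unfolding congruences_iff by (intro conjI ballI allI impI; (rule assms; assumption)?)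

lemma congruence_neq_Id:
  assumes "\<theta> \<in> congruences X U B" "\<theta> \<noteq> Id_on X"
  obtains a b where "(a, b) \<in> \<theta>" "a \<in> X" "b \<in> X" "a \<noteq> b"
  using assms(2) congruencesD(1,2)[OF assms(1)] by (auto simp: Id_on_def)

text \<open>The least congruence is the intersection of all congruences other than the identity. Closure under
  the operations makes \<open>X \<times> X\<close> one of them, so that the intersection is not over an empty family.\<close>

lemma subdirectly_irreducible_iff_pair:
  assumes U: "\<And>f x. f \<in> U \<Longrightarrow> x \<in> X \<Longrightarrow> f x \<in> X"
    and B: "\<And>g x y. g \<in> B \<Longrightarrow> x \<in> X \<Longrightarrow> y \<in> X \<Longrightarrow> g x y \<in> X"
  shows "subdirectly_irreducible X U B \<longleftrightarrow>
    (\<exists>u\<in>X. \<exists>v\<in>X. u \<noteq> v \<and> (\<forall>\<theta>\<in>congruences X U B. \<theta> \<noteq> Id_on X \<longrightarrow> (u, v) \<in> \<theta>))"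
proof
  assume "subdirectly_irreducible X U B"
  then obtain \<mu> where \<mu>: "\<mu> \<in> congruences X U B" "\<mu> \<noteq> Id_on X"
    and least: "\<And>\<theta>. \<theta> \<in> congruences X U B \<Longrightarrow> \<theta> \<noteq> Id_on X \<Longrightarrow> \<mu> \<subseteq> \<theta>"
    unfolding subdirectly_irreducible_def by blast
  obtain u v where "(u, v) \<in> \<mu>" "u \<in> X" "v \<in> X" "u \<noteq> v"
    using congruence_neq_Id[OF \<mu>] .
  then show "\<exists>u\<in>X. \<exists>v\<in>X. u \<noteq> v \<and> (\<forall>\<theta>\<in>congruences X U B. \<theta> \<noteq> Id_on X \<longrightarrow> (u, v) \<in> \<theta>)"
    using least by blast
next
  let ?K = "{\<theta> \<in> congruences X U B. \<theta> \<noteq> Id_on X}"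
  assume "\<exists>u\<in>X. \<exists>v\<in>X. u \<noteq> v \<and> (\<forall>\<theta>\<in>congruences X U B. \<theta> \<noteq> Id_on X \<longrightarrow> (u, v) \<in> \<theta>)"
  then obtain u v where uv: "u \<in> X" "v \<in> X" "u \<noteq> v" and all: "\<And>\<theta>. \<theta> \<in> ?K \<Longrightarrow> (u, v) \<in> \<theta>"
    by blast
  have "X \<times> X \<in> congruences X U B"
    using U B by (intro congruencesI) auto
  moreover have "X \<times> X \<noteq> Id_on X"
    using uv by (auto simp: Id_on_def)
  ultimately have ne: "X \<times> X \<in> ?K" by simp
  have cong: "\<theta> \<in> congruences X U B" if "\<theta> \<in> ?K" for \<theta>
    using that by simp
  have "\<Inter>?K \<in> congruences X U B"
  proof (rule congruencesI)
    show "\<Inter>?K \<subseteq> X \<times> X"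
      using ne by (rule Inter_lower)
    show "(x, x) \<in> \<Inter>?K" if "x \<in> X" for x
      by (rule InterI) (rule congruencesD(2)[OF cong that])
    show "(y, x) \<in> \<Inter>?K" if "(x, y) \<in> \<Inter>?K" for x y
      by (rule InterI) (rule congruencesD(3)[OF cong InterD[OF that]])
    show "(x, z) \<in> \<Inter>?K" if "(x, y) \<in> \<Inter>?K" "(y, z) \<in> \<Inter>?K" for x y z
      by (rule InterI) (rule congruencesD(4)[OF cong InterD[OF that(1)] InterD[OF that(2)]])
    show "(f x, f y) \<in> \<Inter>?K" if "f \<in> U" "(x, y) \<in> \<Inter>?K" for f x y
      by (rule InterI) (rule congruencesD(5)[OF cong that(1) InterD[OF that(2)]])
    show "(g x y, g x' y') \<in> \<Inter>?K"
      if "g \<in> B" "(x, x') \<in> \<Inter>?K" "(y, y') \<in> \<Inter>?K" for g x x' y y'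
      by (rule InterI) (rule congruencesD(6)[OF cong that(1) InterD[OF that(2)] InterD[OF that(3)]])
  qed
  moreover have "(u, v) \<in> \<Inter>?K"
    using all by (rule InterI)
  then have "\<Inter>?K \<noteq> Id_on X"
    using uv(3) by (metis Id_onE Pair_inject)
  moreover have "\<Inter>?K \<subseteq> \<theta>" if "\<theta> \<in> congruences X U B - {Id_on X}" for \<theta>
    using that by (intro Inter_lower) simp
  ultimately show "subdirectly_irreducible X U B"
    using uv unfolding subdirectly_irreducible_def nontrivial_def
    by (intro conjI bexI[of _ "\<Inter>?K"] ballI) auto
qed

context mv_algebra
begin

definition filter_congruence :: "'a set \<Rightarrow> 'a set \<Rightarrow> 'a rel" where
  "filter_congruence X G = {(u, v) \<in> X \<times> X. u \<leadsto> v \<in> G \<and> v \<leadsto> u \<in> G}"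

lemma filter_imp_trans:
  assumes G: "mv_filter A G" and "x \<in> carrier A" "y \<in> carrier A" "z \<in> carrier A"
    and "x \<leadsto> y \<in> G" "y \<leadsto> z \<in> G"
  shows "x \<leadsto> z \<in> G"
  using filter_mp[OF G assms(6) filter_up[OF G assms(5) imp_suffix]] assms(2-4) by simp

lemma filter_odot_cong:
  assumes G: "mv_filter A G" and "x \<in> carrier A" "x' \<in> carrier A" "y \<in> carrier A" "y' \<in> carrier A"
    and "x \<leadsto> x' \<in> G" "y \<leadsto> y' \<in> G"
  shows "(x \<odot> y) \<leadsto> (x' \<odot> y') \<in> G"
proof -
  have mono: "(a \<odot> c) \<leadsto> (b \<odot> c) \<in> G"
    if "a \<leadsto> b \<in> G" "a \<in> carrier A" "b \<in> carrier A" "c \<in> carrier A" for a b c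
  proof -
    have "a \<leadsto> b \<preceq> a \<leadsto> (c \<leadsto> (b \<odot> c))"
      using that by (intro imp_mono le_odot_imp) simp_all
    then show ?thesis
      using filter_up[OF G that(1)] that by (simp add: odot_imp)
  qed
  have "(x \<odot> y) \<leadsto> (x' \<odot> y) \<in> G" "(x' \<odot> y) \<leadsto> (x' \<odot> y') \<in> G"
    using mono[of x x' y] mono[of y y' x'] assms by (simp_all add: odot_commute)
  then show ?thesis
    using filter_imp_trans[OF G _ _ _] assms(2-5) by (meson odot_closed)
qed

lemma filter_imp_cong:
  assumes G: "mv_filter A G" and "x \<in> carrier A" "x' \<in> carrier A" "y \<in> carrier A" "y' \<in> carrier A"
    and "x' \<leadsto> x \<in> G" "y \<leadsto> y' \<in> G"
  shows "(x \<leadsto> y) \<leadsto> (x' \<leadsto> y') \<in> G"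
proof -
  have "(x \<leadsto> y) \<leadsto> (x' \<leadsto> y) \<in> G"
    using filter_up[OF G assms(6) imp_suffix] assms by simp
  moreover have "(x' \<leadsto> y) \<leadsto> (x' \<leadsto> y') \<in> G"
    using filter_up[OF G assms(7) imp_prefix] assms by simp
  ultimately show ?thesis
    using filter_imp_trans[OF G _ _ _] assms(2-5) by (meson imp_closed)
qed

lemma filter_congruence_congruence:
  assumes X: "mv_filter A X" and G: "mv_filter A G" "\<sigma> ` G \<subseteq> G"
    and \<sigma>: "\<sigma> ` X \<subseteq> X" "\<And>x y. x \<in> X \<Longrightarrow> y \<in> X \<Longrightarrow> \<sigma> (x \<leadsto> y) = \<sigma> x \<leadsto> \<sigma> y"
  shows "filter_congruence X G \<in> congruences X {\<sigma>} {mv_odot A, mv_imp A}"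
proof (rule congruencesI)
  note cl = filter_subset[OF X]
  show "(x, z) \<in> filter_congruence X G"
    if "(x, y) \<in> filter_congruence X G" "(y, z) \<in> filter_congruence X G" for x y z
    using that cl filter_imp_trans[OF G(1)] unfolding filter_congruence_def by blast
  show "(f x, f y) \<in> filter_congruence X G"
    if f: "f \<in> {\<sigma>}" and xy: "(x, y) \<in> filter_congruence X G" for f x y
  proof -
    have "\<sigma> (x \<leadsto> y) \<in> G" "\<sigma> (y \<leadsto> x) \<in> G" "x \<in> X" "y \<in> X"
      using xy G(2) unfolding filter_congruence_def by blast+
    then show ?thesis
      using f \<sigma> unfolding filter_congruence_def by auto
  qed
  show "(g x y, g x' y') \<in> filter_congruence X G"
    if g: "g \<in> {mv_odot A, mv_imp A}" and x: "(x, x') \<in> filter_congruence X G"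
      and y: "(y, y') \<in> filter_congruence X G" for g x x' y y'
  proof -
    have *: "x \<in> X" "x' \<in> X" "y \<in> X" "y' \<in> X" "x \<leadsto> x' \<in> G" "x' \<leadsto> x \<in> G" "y \<leadsto> y' \<in> G" "y' \<leadsto> y \<in> G"
      using x y by (auto simp: filter_congruence_def)
    then show ?thesis
      using g cl filter_odot[OF X] filter_imp[OF X] filter_odot_cong[OF G(1)] filter_imp_cong[OF G(1)]
      by (auto simp: filter_congruence_def)
  qed
qed (use filter_subset[OF X] G in \<open>auto simp: filter_congruence_def\<close>)

text \<open>A congruence that identifies some \<open>a \<noteq> b\<close> identifies both \<open>a \<leadsto> b\<close> and \<open>b \<leadsto> a\<close> with \<open>1\<close>, and one
  of these is not \<open>1\<close> by antisymmetry, so its class of \<open>1\<close> is a nontrivial filter. The universe \<open>X\<close>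
  is itself a filter, and \<open>\<sigma>\<close> any operation preserving \<open>\<leadsto>\<close>, so that the criterion covers
  MV-algebras (\<open>\<sigma>\<close> the identity), SMMV-algebras (\<open>\<sigma> = \<tau>\<close>) and the hoop of the elements sent to
  \<open>1\<close> by \<open>\<tau>\<close>.\<close>

lemma subdirectly_irreducible_iff_filter:
  assumes X: "mv_filter A X"
    and \<sigma>: "\<sigma> ` X \<subseteq> X" "\<And>x y. x \<in> X \<Longrightarrow> y \<in> X \<Longrightarrow> \<sigma> (x \<leadsto> y) = \<sigma> x \<leadsto> \<sigma> y"
  shows "subdirectly_irreducible X {\<sigma>} {mv_odot A, mv_imp A} \<longleftrightarrow>
    (\<exists>m\<in>X. m \<noteq> mv_one A \<and>
      (\<forall>G. mv_filter A G \<and> G \<subseteq> X \<and> \<sigma> ` G \<subseteq> G \<and> G \<noteq> {mv_one A} \<longrightarrow> m \<in> G))"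
    (is "?S \<longleftrightarrow> ?M")
proof -
  let ?C = "congruences X {\<sigma>} {mv_odot A, mv_imp A}"
  note cl = filter_subset[OF X]
  have "?S \<longleftrightarrow> (\<exists>u\<in>X. \<exists>v\<in>X. u \<noteq> v \<and> (\<forall>\<theta>\<in>?C. \<theta> \<noteq> Id_on X \<longrightarrow> (u, v) \<in> \<theta>))"
    using X \<sigma>(1) cl filter_odot[OF X] filter_imp[OF X]
    by (intro subdirectly_irreducible_iff_pair) auto
  also have "\<dots> \<longleftrightarrow> ?M"
  proof
    assume "\<exists>u\<in>X. \<exists>v\<in>X. u \<noteq> v \<and> (\<forall>\<theta>\<in>?C. \<theta> \<noteq> Id_on X \<longrightarrow> (u, v) \<in> \<theta>)"
    then obtain u v where uv: "u \<in> X" "v \<in> X" "u \<noteq> v"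
      and all: "\<And>\<theta>. \<theta> \<in> ?C \<Longrightarrow> \<theta> \<noteq> Id_on X \<Longrightarrow> (u, v) \<in> \<theta>"
      by blast
    have "u \<leadsto> v \<in> G \<and> v \<leadsto> u \<in> G"
      if G: "mv_filter A G" "G \<subseteq> X" "\<sigma> ` G \<subseteq> G" "G \<noteq> {mv_one A}" for G
    proof -
      obtain g where g: "g \<in> G" "g \<noteq> mv_one A"
        using G(1,4) filter_one by blast
      then have "(g, mv_one A) \<in> filter_congruence X G"
        using G(1,2) X cl by (auto simp: filter_congruence_def)
      with g(2) have "filter_congruence X G \<noteq> Id_on X"
        by (metis Id_onE Pair_inject)
      then show ?thesis
        using all[OF filter_congruence_congruence[OF X G(1,3) \<sigma>]] by (simp add: filter_congruence_def)
    qed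
    moreover have "u \<leadsto> v \<noteq> mv_one A \<or> v \<leadsto> u \<noteq> mv_one A"
      using le_antisym[of u v] uv cl by (auto simp: mv_le_def)
    moreover have "u \<leadsto> v \<in> X" "v \<leadsto> u \<in> X"
      using uv X cl by (simp_all add: filter_imp)
    ultimately show ?M by meson
  next
    assume ?M
    then obtain m where m: "m \<in> X" "m \<noteq> mv_one A"
      and all: "\<And>G. mv_filter A G \<Longrightarrow> G \<subseteq> X \<Longrightarrow> \<sigma> ` G \<subseteq> G \<Longrightarrow> G \<noteq> {mv_one A} \<Longrightarrow> m \<in> G"
      by blast
    have "(m, mv_one A) \<in> \<theta>" if \<theta>: "\<theta> \<in> ?C" "\<theta> \<noteq> Id_on X" for \<theta>
    proof -
      define G where "G = {a \<in> X. (a, mv_one A) \<in> \<theta>}"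
      note refl = congruencesD(2)[OF \<theta>(1)] and sym = congruencesD(3)[OF \<theta>(1)]
        and trans = congruencesD(4)[OF \<theta>(1)]
      have odot: "(a \<odot> c, b \<odot> d) \<in> \<theta>" and imp: "(a \<leadsto> c, b \<leadsto> d) \<in> \<theta>"
        if "(a, b) \<in> \<theta>" "(c, d) \<in> \<theta>" for a b c d
        using congruencesD(6)[OF \<theta>(1)] that by blast+
      have "mv_filter A G"
      proof (rule filterI)
        fix a b assume "a \<in> G" and b: "b \<in> carrier A" and "a \<leadsto> b \<in> G"
        then have *: "a \<in> X" "a \<leadsto> b \<in> X" "(a, mv_one A) \<in> \<theta>" "(a \<leadsto> b, mv_one A) \<in> \<theta>"
          by (auto simp: G_def)
        then have bX: "b \<in> X"
          using filter_mp[OF X] b by blast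
        have "(a \<leadsto> b, b) \<in> \<theta>"
          using imp[OF *(3) refl[OF bX]] b by simp
        then have "(b, mv_one A) \<in> \<theta>"
          using *(4) sym trans by blast
        then show "b \<in> G"
          using bX by (simp add: G_def)
      qed (use cl X refl in \<open>auto simp: G_def\<close>)
      moreover have "\<sigma> ` G \<subseteq> G"
      proof -
        have "\<sigma> (mv_one A) \<in> carrier A"
          using \<sigma>(1) cl filter_one[OF X] by blast
        then have "\<sigma> (mv_one A) = mv_one A"
          using \<sigma>(2)[of "mv_one A" "mv_one A"] X by simp
        then show ?thesis
          using \<sigma>(1) congruencesD(5)[OF \<theta>(1), of \<sigma> _ "mv_one A"] by (auto simp: G_def)
      qed
      moreover have "G \<noteq> {mv_one A}"
      proof
        assume G1: "G = {mv_one A}"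
        obtain a b where ab: "(a, b) \<in> \<theta>" "a \<in> X" "b \<in> X" "a \<noteq> b"
          using congruence_neq_Id[OF \<theta>] .
        have "(a \<leadsto> b, mv_one A) \<in> \<theta>" "(b \<leadsto> a, mv_one A) \<in> \<theta>"
          using imp[OF ab(1) refl[OF ab(3)]] imp[OF refl[OF ab(3)] ab(1)] ab cl by simp_all
        then have "a \<leadsto> b \<in> G" "b \<leadsto> a \<in> G"
          using ab cl X by (simp_all add: G_def filter_imp)
        then show False
          using G1 ab cl le_antisym[of a b] by (simp add: mv_le_def)
      qed
      ultimately have "m \<in> G"
        using all by (auto simp: G_def)
      then show ?thesis
        by (simp add: G_def)
    qed
    then show "\<exists>u\<in>X. \<exists>v\<in>X. u \<noteq> v \<and> (\<forall>\<theta>\<in>?C. \<theta> \<noteq> Id_on X \<longrightarrow> (u, v) \<in> \<theta>)"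
      using m X by (intro bexI[of _ m] bexI[of _ "mv_one A"]) auto
  qed
  finally show ?thesis .
qed

text \<open>The two sets of operations define each other with the help of the constant \<open>0\<close>, since
  \<open>\<sim> x = x \<leadsto> 0\<close> and \<open>x \<oplus> y = \<sim> x \<leadsto> y\<close>; hence they have the same congruences.\<close>

lemma congruences_hoop_operations:
  "congruences (carrier A) (insert (neg A) U) {oplus A} =
    congruences (carrier A) U {mv_odot A, mv_imp A}"
proof (intro equalityI subsetI)
  fix \<theta> assume \<theta>: "\<theta> \<in> congruences (carrier A) (insert (neg A) U) {oplus A}"
  note neg = congruencesD(5)[OF \<theta> insertI1] and oplus = congruencesD(6)[OF \<theta> singletonI]
  show "\<theta> \<in> congruences (carrier A) U {mv_odot A, mv_imp A}"
  proof (rule congruencesI)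
    show "(f x, f y) \<in> \<theta>" if "f \<in> U" "(x, y) \<in> \<theta>" for f x y
      by (rule congruencesD(5)[OF \<theta> insertI2[OF that(1)] that(2)])
    show "(g x y, g x' y') \<in> \<theta>"
      if "g \<in> {mv_odot A, mv_imp A}" "(x, x') \<in> \<theta>" "(y, y') \<in> \<theta>" for g x x' y y'
      using that(1) neg[OF oplus[OF neg[OF that(2)] neg[OF that(3)]]] oplus[OF neg[OF that(2)] that(3)]
      by (auto simp: mv_odot_def mv_imp_def)
  qed (fact congruencesD(1-4)[OF \<theta>])+
next
  fix \<theta> assume \<theta>: "\<theta> \<in> congruences (carrier A) U {mv_odot A, mv_imp A}"
  have cl: "x \<in> carrier A" "y \<in> carrier A" if "(x, y) \<in> \<theta>" for x y
    using congruencesD(1)[OF \<theta>] that by blast+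
  note imp = congruencesD(6)[OF \<theta> insertI2[OF singletonI]]
  have neg: "(\<sim> x, \<sim> y) \<in> \<theta>" if "(x, y) \<in> \<theta>" for x y
    using imp[OF that congruencesD(2)[OF \<theta> zero_closed]] cl[OF that] by (simp add: neg_as_imp)
  have oplus: "(x \<oplus> y, x' \<oplus> y') \<in> \<theta>" if "(x, x') \<in> \<theta>" "(y, y') \<in> \<theta>" for x x' y y'
    using imp[OF neg[OF that(1)] that(2)] cl[OF that(1)] by (simp add: oplus_as_imp)
  show "\<theta> \<in> congruences (carrier A) (insert (neg A) U) {oplus A}"
  proof (rule congruencesI)
    show "(f x, f y) \<in> \<theta>" if "f \<in> insert (neg A) U" "(x, y) \<in> \<theta>" for f x y
      using that(1) neg[OF that(2)] congruencesD(5)[OF \<theta> _ that(2)] by auto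
    show "(g x y, g x' y') \<in> \<theta>"
      if "g \<in> {oplus A}" "(x, x') \<in> \<theta>" "(y, y') \<in> \<theta>" for g x x' y y'
      using that oplus by simp
  qed (fact congruencesD(1-4)[OF \<theta>])+
qed

lemma congruences_identity_operation:
  assumes "\<And>x. x \<in> X \<Longrightarrow> \<sigma> x = x"
  shows "congruences X {\<sigma>} B = congruences X {} B"
proof (intro equalityI subsetI)
  fix \<theta> assume \<theta>: "\<theta> \<in> congruences X {} B"
  have "(\<sigma> x, \<sigma> y) \<in> \<theta>" if "(x, y) \<in> \<theta>" for x y
    using that assms congruencesD(1)[OF \<theta>] by auto
  then show "\<theta> \<in> congruences X {\<sigma>} B"
    using \<theta> unfolding congruences_def by blast
qed (auto simp: congruences_def)

lemma smmv_subdirectly_irreducible_iff: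
  assumes "smmv_algebra A \<tau>"
  shows "smmv_subdirectly_irreducible A \<tau> \<longleftrightarrow>
    (\<exists>m\<in>carrier A. m \<noteq> mv_one A \<and>
      (\<forall>G. mv_filter A G \<and> \<tau> ` G \<subseteq> G \<and> G \<noteq> {mv_one A} \<longrightarrow> m \<in> G))"
proof -
  have "\<tau> ` carrier A \<subseteq> carrier A" "\<And>x y. x \<in> carrier A \<Longrightarrow> y \<in> carrier A \<Longrightarrow> \<tau> (x \<leadsto> y) = \<tau> x \<leadsto> \<tau> y"
    using assms by (auto simp: smmv_algebra_def mv_hom_def mv_imp_def)
  then have "subdirectly_irreducible (carrier A) {\<tau>} {mv_odot A, mv_imp A} \<longleftrightarrow>
    (\<exists>m\<in>carrier A. m \<noteq> mv_one A \<and> (\<forall>G. mv_filter A G \<and> G \<subseteq> carrier A \<and> \<tau> ` G \<subseteq> G \<and>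
      G \<noteq> {mv_one A} \<longrightarrow> m \<in> G))"
    by (intro subdirectly_irreducible_iff_filter[of "carrier A" \<tau>] filter_carrier)
  moreover have "mv_filter A G \<and> G \<subseteq> carrier A \<longleftrightarrow> mv_filter A G" for G
    by (auto simp: mv_filter_def)
  ultimately show ?thesis
    using assms
    unfolding smmv_subdirectly_irreducible_def subdirectly_irreducible_def congruences_hoop_operations
    by (simp flip: conj_assoc)
qed

lemma mv_subdirectly_irreducible_iff:
  "mv_subdirectly_irreducible A \<longleftrightarrow>
    (\<exists>m\<in>carrier A. m \<noteq> mv_one A \<and> (\<forall>G. mv_filter A G \<and> G \<noteq> {mv_one A} \<longrightarrow> m \<in> G))"
proof -
  have "subdirectly_irreducible (carrier A) {neg A} {oplus A} \<longleftrightarrow>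
      subdirectly_irreducible (carrier A) {\<lambda>x. x} {mv_odot A, mv_imp A}"
    unfolding subdirectly_irreducible_def
    by (simp add: congruences_hoop_operations congruences_identity_operation)
  also have "\<dots> \<longleftrightarrow> (\<exists>m\<in>carrier A. m \<noteq> mv_one A \<and>
      (\<forall>G. mv_filter A G \<and> G \<subseteq> carrier A \<and> (\<lambda>x. x) ` G \<subseteq> G \<and> G \<noteq> {mv_one A} \<longrightarrow> m \<in> G))"
    by (rule subdirectly_irreducible_iff_filter[of "carrier A" "\<lambda>x. x"]) auto
  moreover have "mv_filter A G \<and> G \<subseteq> carrier A \<longleftrightarrow> mv_filter A G" for G
    by (auto simp: mv_filter_def)
  ultimately show ?thesis
    using mv_algebra_axioms by (simp add: mv_subdirectly_irreducible_def flip: conj_assoc)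
qed

lemma hoop_subdirectly_irreducible_iff:
  assumes "mv_filter A X"
  shows "subdirectly_irreducible X {} {mv_odot A, mv_imp A} \<longleftrightarrow>
    (\<exists>m\<in>X. m \<noteq> mv_one A \<and> (\<forall>G. mv_filter A G \<and> G \<subseteq> X \<and> G \<noteq> {mv_one A} \<longrightarrow> m \<in> G))"
proof -
  have "subdirectly_irreducible X {} {mv_odot A, mv_imp A} \<longleftrightarrow>
      subdirectly_irreducible X {\<lambda>x. x} {mv_odot A, mv_imp A}"
    unfolding subdirectly_irreducible_def by (simp add: congruences_identity_operation)
  also have "\<dots> \<longleftrightarrow> (\<exists>m\<in>X. m \<noteq> mv_one A \<and>
      (\<forall>G. mv_filter A G \<and> G \<subseteq> X \<and> (\<lambda>x. x) ` G \<subseteq> G \<and> G \<noteq> {mv_one A} \<longrightarrow> m \<in> G))"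
    using assms by (intro subdirectly_irreducible_iff_filter[of X "\<lambda>x. x"]) auto
  finally show ?thesis
    by simp
qed

end

section \<open>Quotients\<close>

context mv_algebra
begin

lemma hom_simps:
  assumes "h \<in> mv_hom A B"
  shows "x \<in> carrier A \<Longrightarrow> h x \<in> carrier B"
    and "h \<zero> = \<zero>\<^bsub>B\<^esub>"
    and "h (mv_one A) = mv_one B"
    and "x \<in> carrier A \<Longrightarrow> h (\<sim> x) = \<sim>\<^bsub>B\<^esub> h x"
    and "x \<in> carrier A \<Longrightarrow> y \<in> carrier A \<Longrightarrow> h (x \<oplus> y) = h x \<oplus>\<^bsub>B\<^esub> h y"
    and "x \<in> carrier A \<Longrightarrow> y \<in> carrier A \<Longrightarrow> h (x \<leadsto> y) = h x \<leadsto>\<^bsub>B\<^esub> h y"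
    and "x \<in> carrier A \<Longrightarrow> y \<in> carrier A \<Longrightarrow> h (x \<odot> y) = h x \<odot>\<^bsub>B\<^esub> h y"
    and "x \<in> carrier A \<Longrightarrow> y \<in> carrier A \<Longrightarrow> h (x \<curlyvee> y) = h x \<curlyvee>\<^bsub>B\<^esub> h y"
  using assms by (auto simp: mv_hom_def mv_one_def mv_imp_def mv_odot_def mv_join_def)

lemma hom_image_algebra:
  assumes h: "h \<in> mv_hom A B" and surj: "h ` carrier A = carrier B"
  shows "mv_algebra B"
proof -
  note hom = hom_simps(2-6)[OF h, symmetric]
  have all: "(\<forall>y\<in>carrier B. Q y) \<longleftrightarrow> (\<forall>x\<in>carrier A. Q (h x))" for Q
    unfolding surj[symmetric] by simp
  have "h x \<oplus>\<^bsub>B\<^esub> h y \<oplus>\<^bsub>B\<^esub> h z = h x \<oplus>\<^bsub>B\<^esub> (h y \<oplus>\<^bsub>B\<^esub> h z)"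
    if "x \<in> carrier A" "y \<in> carrier A" "z \<in> carrier A" for x y z
    using that by (simp add: hom oplus_assoc)
  moreover have "h x \<oplus>\<^bsub>B\<^esub> h y = h y \<oplus>\<^bsub>B\<^esub> h x" if "x \<in> carrier A" "y \<in> carrier A" for x y
    using that by (simp add: hom oplus_commute)
  moreover have "(h x \<leadsto>\<^bsub>B\<^esub> h y) \<leadsto>\<^bsub>B\<^esub> h y = (h y \<leadsto>\<^bsub>B\<^esub> h x) \<leadsto>\<^bsub>B\<^esub> h x"
    if "x \<in> carrier A" "y \<in> carrier A" for x y
    using that imp_imp[of x y] by (simp add: hom)
  moreover have "h x \<in> carrier B" if "x \<in> carrier A" for x
    using that surj by blast
  ultimately show ?thesis
    unfolding mv_algebra_alt all
    by (intro conjI ballI) (simp_all add: hom oplus_one)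
qed

text \<open>The quotient \<open>A / P\<close>, with operations on classes computed on chosen representatives.\<close>

lemma quotient_exists:
  assumes P: "mv_filter A P"
  obtains Q :: "'a set mv_algebra" and q where "q \<in> mv_hom A Q" "q ` carrier A = carrier Q"
    "\<forall>x\<in>carrier A. \<forall>y\<in>carrier A. q x = q y \<longleftrightarrow> x \<leadsto> y \<in> P \<and> y \<leadsto> x \<in> P"
proof -
  let ?\<theta> = "filter_congruence (carrier A) P"
  define q where "q x = ?\<theta> `` {x}" for x
  define rep where "rep = inv_into (carrier A) q"
  define Q where "Q = \<lparr>carrier = q ` carrier A, oplus = (\<lambda>X Y. q (rep X \<oplus> rep Y)),
    neg = (\<lambda>X. q (\<sim> rep X)), mv_zero = q \<zero>\<rparr>"
  have "?\<theta> \<in> congruences (carrier A) {\<lambda>x. x} {mv_odot A, mv_imp A}"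
    by (rule filter_congruence_congruence) (use P in auto)
  then have \<theta>: "?\<theta> \<in> congruences (carrier A) {neg A} {oplus A}"
    by (simp add: congruences_hoop_operations congruences_identity_operation)
  then have "equiv (carrier A) ?\<theta>"
    by (simp add: congruences_def)
  then have q_eq: "q x = q y \<longleftrightarrow> (x, y) \<in> ?\<theta>" if "x \<in> carrier A" "y \<in> carrier A" for x y
    using that unfolding q_def by (rule eq_equiv_class_iff)
  have rep: "rep (q x) \<in> carrier A" "(x, rep (q x)) \<in> ?\<theta>" if "x \<in> carrier A" for x
  proof -
    show "rep (q x) \<in> carrier A"
      using that unfolding rep_def by (intro inv_into_into) blast
    then show "(x, rep (q x)) \<in> ?\<theta>"
      using that q_eq f_inv_into_f[of "q x" q "carrier A"] unfolding rep_def by blast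
  qed
  have "q \<in> mv_hom A Q"
    unfolding mv_hom_def mem_Collect_eq
  proof (intro conjI ballI)
    fix x y assume x: "x \<in> carrier A" and y: "y \<in> carrier A"
    show "q (\<sim> x) = \<sim>\<^bsub>Q\<^esub> q x"
      using x rep congruencesD(5)[OF \<theta> singletonI rep(2)[OF x]] by (simp add: Q_def q_eq)
    show "q (x \<oplus> y) = q x \<oplus>\<^bsub>Q\<^esub> q y"
      using x y rep congruencesD(6)[OF \<theta> singletonI rep(2)[OF x] rep(2)[OF y]]
      by (simp add: Q_def q_eq)
  qed (auto simp: Q_def)
  moreover have "q ` carrier A = carrier Q"
    by (simp add: Q_def)
  moreover have "\<forall>x\<in>carrier A. \<forall>y\<in>carrier A. q x = q y \<longleftrightarrow> x \<leadsto> y \<in> P \<and> y \<leadsto> x \<in> P"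
    by (simp add: q_eq filter_congruence_def)
  ultimately show ?thesis
    by (rule that)
qed

end

section \<open>Necessity of the three types\<close>

locale smmv = mv_algebra A
  for A :: "'a mv_algebra" (structure) and \<tau> :: "'a \<Rightarrow> 'a" +
  assumes smmv: "smmv_algebra A \<tau>"
begin

lemma tau_hom: "\<tau> \<in> mv_hom A A"
  using smmv by (simp add: smmv_algebra_def)

lemmas tau_simps [simp] = hom_simps[OF tau_hom]

lemma tau_tau [simp]: "x \<in> carrier A \<Longrightarrow> \<tau> (\<tau> x) = \<tau> x"
  using smmv by (simp add: smmv_algebra_def)

lemma filter_F_tau: "mv_filter A (F_tau A \<tau>)"
  by (rule filterI) (auto simp: F_tau_def)

text \<open>The largest \<open>\<tau>\<close>-filter inside \<open>N\<close>.\<close>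

lemma filter_tau_core:
  assumes "mv_filter A N"
  shows "mv_filter A {a \<in> N. \<tau> a \<in> N}" "\<tau> ` {a \<in> N. \<tau> a \<in> N} \<subseteq> {a \<in> N. \<tau> a \<in> N}"
proof -
  note cl = filter_subset[OF assms]
  show "mv_filter A {a \<in> N. \<tau> a \<in> N}"
  proof (rule filterI)
    fix a b assume "a \<in> {a \<in> N. \<tau> a \<in> N}" "b \<in> carrier A" "a \<leadsto> b \<in> {a \<in> N. \<tau> a \<in> N}"
    then show "b \<in> {a \<in> N. \<tau> a \<in> N}"
      using filter_mp[OF assms, of a b] filter_mp[OF assms, of "\<tau> a" "\<tau> b"] cl by simp
  qed (use assms cl in auto)
  show "\<tau> ` {a \<in> N. \<tau> a \<in> N} \<subseteq> {a \<in> N. \<tau> a \<in> N}"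
    using cl by auto
qed

text \<open>The \<open>\<tau>\<close>-closed core \<open>G\<close> of the polar of \<open>{y, \<tau> y}\<close> contains \<open>x\<close>, the core \<open>H\<close> of the polar of
  \<open>G\<close> contains \<open>y\<close>, and \<open>G\<close> meets \<open>H\<close> in \<open>1\<close> only. By subdirect irreducibility one of them is
  trivial.\<close>

lemma subdirectly_irreducible_orthogonal:
  assumes si: "smmv_subdirectly_irreducible A \<tau>"
    and x: "x \<in> carrier A" and y: "y \<in> carrier A"
    and "x \<curlyvee> y = mv_one A" "\<tau> x \<curlyvee> y = mv_one A" "x \<curlyvee> \<tau> y = mv_one A"
  shows "x = mv_one A \<or> y = mv_one A"
proof (rule ccontr)
  assume ne: "\<not> (x = mv_one A \<or> y = mv_one A)"
  obtain m where m: "m \<in> carrier A" "m \<noteq> mv_one A"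
    and least: "\<And>G. mv_filter A G \<Longrightarrow> \<tau> ` G \<subseteq> G \<Longrightarrow> G \<noteq> {mv_one A} \<Longrightarrow> m \<in> G"
    using si smmv_subdirectly_irreducible_iff[OF smmv] by blast
  define N where "N = {z \<in> carrier A. \<forall>u\<in>{y, \<tau> y}. z \<curlyvee> u = mv_one A}"
  define G where "G = {a \<in> N. \<tau> a \<in> N}"
  define N' where "N' = {z \<in> carrier A. \<forall>u\<in>G. z \<curlyvee> u = mv_one A}"
  define H where "H = {b \<in> N'. \<tau> b \<in> N'}"
  have N: "mv_filter A N"
    unfolding N_def using y by (intro filter_polar) simp
  have G: "mv_filter A G" "\<tau> ` G \<subseteq> G"
    unfolding G_def using filter_tau_core[OF N] by simp_all
  have N': "mv_filter A N'"
    unfolding N'_def using G(1) filter_subset by (intro filter_polar) blast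
  have H: "mv_filter A H" "\<tau> ` H \<subseteq> H"
    unfolding H_def using filter_tau_core[OF N'] by simp_all
  have "\<tau> x \<curlyvee> \<tau> y = mv_one A"
    using x y assms(4) tau_simps(8)[of x y] by simp
  then have "x \<in> G"
    using x y assms(4-6) by (simp add: G_def N_def)
  moreover have "y \<curlyvee> a = mv_one A" "\<tau> y \<curlyvee> a = mv_one A" if "a \<in> G" for a
    using that y join_commute by (simp_all add: G_def N_def)
  then have "y \<in> H"
    using y by (simp add: H_def N'_def)
  ultimately have "G \<noteq> {mv_one A}" "H \<noteq> {mv_one A}"
    using ne by blast+
  then have "m \<in> G" "m \<in> H"
    using least G H by blast+
  then have "m \<curlyvee> m = mv_one A"
    unfolding H_def N'_def by blast
  then show False
    using m by simp
qed

text \<open>An element \<open>x\<close> and its image \<open>\<tau> x\<close> differ by elements of the kernel, as \<open>\<tau>\<close> is idempotent.\<close>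

lemma imp_tau_in_F_tau:
  assumes "x \<in> carrier A"
  shows "x \<leadsto> \<tau> x \<in> F_tau A \<tau>" "\<tau> x \<leadsto> x \<in> F_tau A \<tau>"
  using assms by (simp_all add: F_tau_def)

lemma tau_identity:
  assumes "F_tau A \<tau> = {mv_one A}" "x \<in> carrier A"
  shows "\<tau> x = x"
  using imp_tau_in_F_tau[OF assms(2)] assms le_antisym[of "\<tau> x" x] by (simp add: mv_le_def)

lemma type_I_iff:
  assumes "\<And>x. x \<in> carrier A \<Longrightarrow> \<tau> x = x"
  shows "smmv_subdirectly_irreducible A \<tau> \<longleftrightarrow> mv_subdirectly_irreducible A"
proof -
  have "\<tau> ` G \<subseteq> G" if "mv_filter A G" for G
    using assms filter_subset[OF that] by auto
  then show ?thesis
    unfolding smmv_subdirectly_irreducible_iff[OF smmv] mv_subdirectly_irreducible_iff by metis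
qed

text \<open>The decomposition behind types L and D: \<open>F\<close> and its polar \<open>P\<close>, called \<open>kernel_polar\<close>, are prime
  filters with trivial intersection, whence \<open>A\<close> embeds into the product of the chains \<open>A / F\<close>,
  which is \<open>\<tau>(A)\<close>, and \<open>A / P\<close>; as \<open>P\<close> meets \<open>\<tau>(A)\<close> trivially, the first of these chains embeds
  into the second.\<close>

context
  assumes si: "smmv_subdirectly_irreducible A \<tau>"
    and kernel: "F_tau A \<tau> \<noteq> {mv_one A}"
begin

abbreviation (input) "F \<equiv> F_tau A \<tau>"

definition kernel_polar :: "'a set" where
  "kernel_polar = {z \<in> carrier A. \<forall>x\<in>F. z \<curlyvee> x = mv_one A}"

lemma F_subset: "x \<in> F \<Longrightarrow> x \<in> carrier A"
  by (simp add: F_tau_def)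

lemma kernel_nonunit:
  obtains x where "x \<in> F" "x \<noteq> mv_one A"
  using kernel filter_one[OF filter_F_tau] by blast

lemma disjunction: "disjunction_property A \<tau>"
  unfolding disjunction_property_def
  using subdirectly_irreducible_orthogonal[OF si] by (auto simp: F_tau_def)

lemma filter_P: "mv_filter A kernel_polar"
  unfolding kernel_polar_def using F_subset by (intro filter_polar) blast

lemma F_Int_P: "F \<inter> kernel_polar = {mv_one A}"
proof -
  have "z = mv_one A" if "z \<in> F" "z \<in> kernel_polar" for z
    using that F_subset[of z] by (auto simp: kernel_polar_def dest: bspec[of _ _ z])
  then show ?thesis
    using filter_one[OF filter_F_tau] filter_one[OF filter_P] by blast
qed

lemma image_Int_P:
  assumes "y \<in> carrier A" "\<tau> y \<in> kernel_polar"
  shows "\<tau> y = mv_one A"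
proof -
  obtain x where x: "x \<in> F" "x \<noteq> mv_one A"
    by (rule kernel_nonunit)
  then have "x \<curlyvee> \<tau> y = mv_one A"
    using assms F_subset by (simp add: kernel_polar_def join_commute)
  then show ?thesis
    using disjunction x assms(1) unfolding disjunction_property_def by blast
qed

lemma F_prime:
  assumes "a \<in> carrier A" "b \<in> carrier A"
  shows "a \<leadsto> b \<in> F \<or> b \<leadsto> a \<in> F"
  using subdirectly_irreducible_orthogonal[OF si, of "\<tau> a \<leadsto> \<tau> b" "\<tau> b \<leadsto> \<tau> a"] assms
  by (simp add: prelinearity F_tau_def)

lemma F_coprime:
  assumes "x \<in> F" "y \<in> F" "x \<curlyvee> y = mv_one A"
  shows "x = mv_one A \<or> y = mv_one A"
  using subdirectly_irreducible_orthogonal[OF si, of x y] assms by (simp add: F_tau_def)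

text \<open>If neither \<open>a \<leadsto> b\<close> nor \<open>b \<leadsto> a\<close> lies in \<open>P\<close>, then their joins with suitable members of \<open>F\<close> are
  two elements of \<open>F\<close> other than \<open>1\<close> with join \<open>1\<close>.\<close>

lemma P_prime:
  assumes "a \<in> carrier A" "b \<in> carrier A"
  shows "a \<leadsto> b \<in> kernel_polar \<or> b \<leadsto> a \<in> kernel_polar"
proof (rule ccontr)
  let ?u = "a \<leadsto> b" and ?v = "b \<leadsto> a"
  assume "\<not> (?u \<in> kernel_polar \<or> ?v \<in> kernel_polar)"
  then obtain x y where x: "x \<in> F" "?u \<curlyvee> x \<noteq> mv_one A" and y: "y \<in> F" "?v \<curlyvee> y \<noteq> mv_one A"
    using assms by (auto simp: kernel_polar_def)
  let ?j = "(?u \<curlyvee> x) \<curlyvee> (?v \<curlyvee> y)"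
  have cl: "x \<in> carrier A" "y \<in> carrier A"
    using x y F_subset by blast+
  have "?u \<preceq> ?j"
    using assms cl by (intro le_trans[OF _ _ _ join_upper1 join_upper1]) simp_all
  moreover have "?v \<preceq> ?j"
    using assms cl by (intro le_trans[OF _ _ _ join_upper1 join_upper2]) simp_all
  ultimately have "?u \<curlyvee> ?v \<preceq> ?j"
    using assms cl by (intro join_least) simp_all
  then have "?j = mv_one A"
    using assms cl by (simp add: prelinearity mv_le_def)
  moreover have "?u \<curlyvee> x \<in> F" "?v \<curlyvee> y \<in> F"
    using x y assms filter_join(2)[OF filter_F_tau] by simp_all
  ultimately show False
    using F_coprime x y by blast
qed

lemma hoop_F_subdirectly_irreducible: "nontrivial F" "F_tau_subdirectly_irreducible A \<tau>"
proof -
  show "nontrivial F"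
    using kernel_nonunit filter_one[OF filter_F_tau] unfolding nontrivial_def by metis
  obtain m where m: "m \<noteq> mv_one A"
    and least: "\<And>G. mv_filter A G \<Longrightarrow> \<tau> ` G \<subseteq> G \<Longrightarrow> G \<noteq> {mv_one A} \<Longrightarrow> m \<in> G"
    using si smmv_subdirectly_irreducible_iff[OF smmv] by blast
  have "m \<in> G" if "mv_filter A G" "G \<subseteq> F" "G \<noteq> {mv_one A}" for G
  proof (rule least[OF that(1) _ that(3)])
    show "\<tau> ` G \<subseteq> G"
      using that(1,2) filter_one by (auto simp: F_tau_def)
  qed
  moreover have "m \<in> F"
    using calculation[OF filter_F_tau] kernel by blast
  ultimately show "F_tau_subdirectly_irreducible A \<tau>"
    unfolding F_tau_subdirectly_irreducible_def hoop_subdirectly_irreducible_iff[OF filter_F_tau]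
    using m by blast
qed

context
  fixes Q :: "'a set mv_algebra" and q :: "'a \<Rightarrow> 'a set"
  assumes q: "q \<in> mv_hom A Q" and q_surj: "q ` carrier A = carrier Q"
    and q_eq: "\<And>x y. x \<in> carrier A \<Longrightarrow> y \<in> carrier A \<Longrightarrow>
      q x = q y \<longleftrightarrow> x \<leadsto> y \<in> kernel_polar \<and> y \<leadsto> x \<in> kernel_polar"
begin

lemma quotient_algebra: "mv_algebra Q"
  using hom_image_algebra[OF q q_surj] .

lemma quotient_chain: "mv_chain Q"
proof -
  have "mv_le Q (q a) (q b)" if "a \<in> carrier A" "b \<in> carrier A" "a \<leadsto> b \<in> kernel_polar" for a b
  proof -
    have "q (a \<leadsto> b) = q (mv_one A)"
      using that q_eq filter_one[OF filter_P] by simp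
    then show ?thesis
      using that by (simp add: mv_le_def hom_simps[OF q])
  qed
  then have "mv_le Q (q a) (q b) \<or> mv_le Q (q b) (q a)" if "a \<in> carrier A" "b \<in> carrier A" for a b
    using P_prime[OF that] that by blast
  then show ?thesis
    unfolding mv_chain_def q_surj[symmetric] using quotient_algebra by blast
qed

lemma quotient_eq_one: "x \<in> carrier A \<Longrightarrow> q x = mv_one Q \<longleftrightarrow> x \<in> kernel_polar"
  using q_eq[of x "mv_one A"] filter_one[OF filter_P] by (simp add: hom_simps[OF q])

text \<open>Let \<open>m\<close> be a member of all nontrivial filters inside \<open>F\<close>. A nontrivial filter of \<open>A / P\<close> has a
  preimage \<open>K\<close> that is larger than \<open>P\<close>, the polar of \<open>F\<close>, so \<open>K\<close> meets \<open>F\<close> outside \<open>1\<close> and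
  \<open>m \<in> K\<close>.\<close>

lemma quotient_subdirectly_irreducible: "mv_subdirectly_irreducible Q"
proof -
  interpret Q: mv_algebra Q
    by (rule quotient_algebra)
  obtain m where m: "m \<in> F" "m \<noteq> mv_one A"
    and least: "\<And>G. mv_filter A G \<Longrightarrow> G \<subseteq> F \<Longrightarrow> G \<noteq> {mv_one A} \<Longrightarrow> m \<in> G"
    using hoop_F_subdirectly_irreducible(2)
    unfolding F_tau_subdirectly_irreducible_def hoop_subdirectly_irreducible_iff[OF filter_F_tau] by blast
  have "q m \<noteq> mv_one Q"
    using m F_Int_P F_subset quotient_eq_one by blast
  moreover have "q m \<in> G" if G: "mv_filter Q G" "G \<noteq> {mv_one Q}" for G
  proof -
    define K where "K = {x \<in> carrier A. q x \<in> G}"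
    have K: "mv_filter A K"
    proof (rule filterI)
      fix a b assume "a \<in> K" "b \<in> carrier A" "a \<leadsto> b \<in> K"
      then show "b \<in> K"
        using Q.filter_mp[OF G(1), of "q a" "q b"] by (simp add: K_def hom_simps[OF q])
    qed (use G(1) in \<open>auto simp: K_def hom_simps[OF q]\<close>)
    obtain c where c: "c \<in> G" "c \<noteq> mv_one Q"
      using G Q.filter_one by blast
    then obtain g where g: "g \<in> carrier A" "c = q g"
      using Q.filter_subset[OF G(1)] unfolding q_surj[symmetric] by blast
    then have "g \<in> K" "g \<notin> kernel_polar"
      using c quotient_eq_one by (auto simp: K_def)
    then obtain x where x: "x \<in> F" "g \<curlyvee> x \<noteq> mv_one A"
      using g(1) by (auto simp: kernel_polar_def)
    then have "g \<curlyvee> x \<in> F \<inter> K"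
      using g(1) \<open>g \<in> K\<close> F_subset filter_join(1)[OF K] filter_join(2)[OF filter_F_tau] by blast
    then have "m \<in> F \<inter> K"
      using x(2) by (intro least filter_Int filter_F_tau K) auto
    then show ?thesis
      by (simp add: K_def)
  qed
  moreover have "q m \<in> carrier Q"
    using m(1) F_subset by (simp add: hom_simps[OF q])
  ultimately show ?thesis
    unfolding Q.mv_subdirectly_irreducible_iff by blast
qed

definition embedding :: "'a \<Rightarrow> 'a set \<times> 'a set" where
  "embedding x = (q (\<tau> x), q x)"

definition tau_image :: "'a set set" where
  "tau_image = (q \<circ> \<tau>) ` carrier A"

lemma tau_image_subalgebra: "mv_subalgebra tau_image Q"
  unfolding mv_subalgebra_def
proof (intro conjI ballI)
  show "tau_image \<subseteq> carrier Q"
    by (auto simp: tau_image_def hom_simps[OF q])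
  show "\<zero>\<^bsub>Q\<^esub> \<in> tau_image"
    by (auto simp: tau_image_def hom_simps[OF q] intro!: image_eqI[of _ _ "\<zero>"])
  show "\<sim>\<^bsub>Q\<^esub> x \<in> tau_image" if x: "x \<in> tau_image" for x
  proof -
    obtain a where "a \<in> carrier A" "x = q (\<tau> a)"
      using x by (auto simp: tau_image_def)
    then show ?thesis
      by (auto simp: tau_image_def hom_simps[OF q] intro!: image_eqI[of _ _ "\<sim> a"])
  qed
  show "x \<oplus>\<^bsub>Q\<^esub> y \<in> tau_image" if xy: "x \<in> tau_image" "y \<in> tau_image" for x y
  proof -
    obtain a b where "a \<in> carrier A" "x = q (\<tau> a)" "b \<in> carrier A" "y = q (\<tau> b)"
      using xy by (auto simp: tau_image_def)
    then show ?thesis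
      by (auto simp: tau_image_def hom_simps[OF q] intro!: image_eqI[of _ _ "a \<oplus> b"])
  qed
qed

lemma embedding_inj: "inj_on embedding (carrier A)"
proof (rule inj_onI)
  fix x y assume x: "x \<in> carrier A" and y: "y \<in> carrier A" and eq: "embedding x = embedding y"
  have "a \<preceq> b" if a: "a \<in> carrier A" and b: "b \<in> carrier A" and ab: "embedding a = embedding b" for a b
  proof -
    have "\<tau> (a \<leadsto> b) \<in> kernel_polar" "a \<leadsto> b \<in> kernel_polar"
      using ab a b q_eq by (simp_all add: embedding_def)
    then have "a \<leadsto> b \<in> F \<inter> kernel_polar"
      using image_Int_P[of "a \<leadsto> b"] a b by (simp add: F_tau_def)
    then show ?thesis
      using F_Int_P by (simp add: mv_le_def)
  qed
  then show "x = y"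
    using x y eq le_antisym by metis
qed

lemma embedding_isomorphic:
  assumes "embedding ` carrier A = S"
  shows "smmv_isomorphic A \<tau> ((mv_prod (Q\<lparr>carrier := tau_image\<rparr>) Q)\<lparr>carrier := S\<rparr>) diag_op"
  unfolding smmv_isomorphic_def
proof (intro bexI conjI ballI)
  show "embedding \<in> mv_hom A ((mv_prod (Q\<lparr>carrier := tau_image\<rparr>) Q)\<lparr>carrier := S\<rparr>)"
    using assms by (auto simp: mv_hom_def embedding_def hom_simps[OF q])
  show "bij_betw embedding (carrier A) (carrier ((mv_prod (Q\<lparr>carrier := tau_image\<rparr>) Q)\<lparr>carrier := S\<rparr>))"
    using embedding_inj assms by (simp add: bij_betw_def)
  show "embedding (\<tau> x) = diag_op (embedding x)" if "x \<in> carrier A" for x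
    using that by (simp add: embedding_def diag_op_def)
qed

lemma embedding_subalgebra:
  "smmv_subalgebra (embedding ` carrier A) (mv_prod (Q\<lparr>carrier := tau_image\<rparr>) Q) diag_op"
  unfolding mv_prod_closed_iff
proof (intro conjI allI impI)
  let ?S = "embedding ` carrier A"
  show "?S \<subseteq> tau_image \<times> carrier Q"
    by (auto simp: embedding_def tau_image_def hom_simps[OF q])
  show "(\<zero>\<^bsub>Q\<^esub>, \<zero>\<^bsub>Q\<^esub>) \<in> ?S"
    by (rule image_eqI[of _ _ "\<zero>"]) (simp_all add: embedding_def hom_simps[OF q])
  fix x y assume "(x, y) \<in> ?S"
  then obtain a where a: "a \<in> carrier A" "x = q (\<tau> a)" "y = q a"
    by (auto simp: embedding_def)
  show "(\<sim>\<^bsub>Q\<^esub> x, \<sim>\<^bsub>Q\<^esub> y) \<in> ?S"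
    by (rule image_eqI[of _ _ "\<sim> a"]) (use a in \<open>simp_all add: embedding_def hom_simps[OF q]\<close>)
  show "(x, x) \<in> ?S"
    by (rule image_eqI[of _ _ "\<tau> a"]) (use a in \<open>simp_all add: embedding_def\<close>)
  fix x' y' assume "(x', y') \<in> ?S"
  then obtain b where b: "b \<in> carrier A" "x' = q (\<tau> b)" "y' = q b"
    by (auto simp: embedding_def)
  show "(x \<oplus>\<^bsub>Q\<^esub> x', y \<oplus>\<^bsub>Q\<^esub> y') \<in> ?S"
    by (rule image_eqI[of _ _ "a \<oplus> b"]) (use a b in \<open>simp_all add: embedding_def hom_simps[OF q]\<close>)
qed

lemma subdiagonal: "subdiagonal A \<tau>"
proof (rule subdiagonal_any_type[OF _ embedding_subalgebra embedding_isomorphic])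
  show "diagonal (mv_prod (Q\<lparr>carrier := tau_image\<rparr>) Q) diag_op"
    unfolding diagonal_def
    using quotient_chain tau_image_subalgebra mv_subalgebra_chain by blast
qed simp

text \<open>Chinese remainders: with \<open>x \<in> F\<close> and \<open>\<sim> x \<in> P\<close> the element \<open>(a \<odot> x) \<oplus> (b \<odot> \<sim> x)\<close> is
  congruent to \<open>a\<close> modulo \<open>F\<close> and to \<open>b\<close> modulo \<open>P\<close>.\<close>

lemma embedding_surj:
  assumes "\<not> mv_local A"
  shows "embedding ` carrier A = tau_image \<times> carrier Q"
proof (intro equalityI subsetI)
  interpret Q: mv_algebra Q
    by (rule quotient_algebra)
  obtain x p where x: "x \<in> F" and p: "p \<in> kernel_polar" "p \<preceq> \<sim> x"
    using not_local_comaximal[OF filter_F_tau F_prime filter_P P_prime F_Int_P assms] .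
  have xA: "x \<in> carrier A" and tx: "\<tau> x = mv_one A"
    using x by (simp_all add: F_tau_def)
  have "\<sim> x \<in> kernel_polar"
    using filter_up[OF filter_P p] xA by simp
  then have "q (\<sim> x) = mv_one Q"
    using quotient_eq_one xA by simp
  then have "\<sim>\<^bsub>Q\<^esub> \<sim>\<^bsub>Q\<^esub> q x = \<zero>\<^bsub>Q\<^esub>"
    using xA by (simp add: hom_simps[OF q] Q.neg_one)
  then have qx: "q x = \<zero>\<^bsub>Q\<^esub>" "\<sim>\<^bsub>Q\<^esub> \<zero>\<^bsub>Q\<^esub> = mv_one Q"
    using xA by (simp_all add: hom_simps[OF q] mv_one_def)
  fix c assume "c \<in> tau_image \<times> carrier Q"
  then obtain a b where a: "a \<in> carrier A" and b: "b \<in> carrier A" and c: "c = (q (\<tau> a), q b)"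
    unfolding tau_image_def q_surj[symmetric] by auto
  have "embedding ((a \<odot> x) \<oplus> (b \<odot> \<sim> x)) = c"
    using a b xA tx qx by (simp add: embedding_def c neg_one hom_simps[OF q])
  then show "c \<in> embedding ` carrier A"
    using a b xA by (intro image_eqI[of _ _ "(a \<odot> x) \<oplus> (b \<odot> \<sim> x)"]) simp_all
qed (auto simp: embedding_def tau_image_def hom_simps[OF q])

lemma not_local_type_D:
  assumes "\<not> mv_local A"
  shows "type_D A \<tau>"
proof (rule type_D_any_type[OF quotient_subdirectly_irreducible tau_image_subalgebra])
  have "(mv_prod (Q\<lparr>carrier := tau_image\<rparr>) Q)\<lparr>carrier := tau_image \<times> carrier Q\<rparr> = mv_prod (Q\<lparr>carrier := tau_image\<rparr>) Q"
    by (simp add: mv_prod_def)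
  then show "smmv_isomorphic A \<tau> (mv_prod (Q\<lparr>carrier := tau_image\<rparr>) Q) diag_op"
    using embedding_isomorphic[OF embedding_surj[OF assms]] by (simp only:)
qed

end

lemma type_L_or_D: "type_L A \<tau> \<or> type_D A \<tau>"
proof -
  obtain Q :: "'a set mv_algebra" and q where q: "q \<in> mv_hom A Q" "q ` carrier A = carrier Q"
    and eq: "\<forall>x\<in>carrier A. \<forall>y\<in>carrier A.
      q x = q y \<longleftrightarrow> x \<leadsto> y \<in> kernel_polar \<and> y \<leadsto> x \<in> kernel_polar"
    by (rule quotient_exists[OF filter_P]) (rule that)
  have "subdiagonal A \<tau>"
    by (rule subdiagonal[OF q]) (use eq in blast)
  moreover have "type_D A \<tau>" if "\<not> mv_local A"
    by (rule not_local_type_D[OF q _ that]) (use eq in blast)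
  ultimately show ?thesis
    using hoop_F_subdirectly_irreducible disjunction unfolding type_L_def by blast
qed

end

section \<open>Sufficiency and disjointness\<close>

text \<open>If a \<open>\<tau>\<close>-filter meets the kernel trivially, then \<open>\<tau>\<close> fixes its members; a member \<open>g\<close> other than
  \<open>1\<close> would have join \<open>1\<close> with every element of the kernel, against the disjunction property.\<close>

lemma type_L_subdirectly_irreducible:
  assumes "type_L A \<tau>"
  shows "smmv_subdirectly_irreducible A \<tau>"
proof -
  let ?F = "F_tau A \<tau>"
  have disj: "x = mv_one A \<or> y = mv_one A"
    if "x \<in> ?F" "y \<in> \<tau> ` carrier A" "x \<curlyvee> y = mv_one A" for x y
    using assms that unfolding type_L_def disjunction_property_def by blast
  obtain m where m: "m \<in> ?F" "m \<noteq> mv_one A"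
    and least: "\<And>G. mv_filter A G \<Longrightarrow> G \<subseteq> ?F \<Longrightarrow> G \<noteq> {mv_one A} \<Longrightarrow> m \<in> G"
    using assms unfolding type_L_def F_tau_subdirectly_irreducible_def
      hoop_subdirectly_irreducible_iff[OF filter_F_tau] by blast
  have mA: "m \<in> carrier A"
    using m by (simp add: F_tau_def)
  have "m \<in> G" if G: "mv_filter A G" "\<tau> ` G \<subseteq> G" "G \<noteq> {mv_one A}" for G
  proof -
    have "?F \<inter> G \<noteq> {mv_one A}"
    proof
      assume FG: "?F \<inter> G = {mv_one A}"
      obtain g where g: "g \<in> G" "g \<noteq> mv_one A"
        using G(1,3) filter_one by blast
      have gA: "g \<in> carrier A" and tg: "\<tau> g \<in> G"
        using g(1) G filter_subset by blast+
      have "g \<leadsto> \<tau> g \<in> ?F \<inter> G" "\<tau> g \<leadsto> g \<in> ?F \<inter> G"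
        using imp_tau_in_F_tau[OF gA] filter_imp[OF G(1)] g(1) gA tg by simp_all
      then have "\<tau> g = g"
        using FG gA le_antisym[of "\<tau> g" g] by (simp add: mv_le_def)
      then have "g \<in> \<tau> ` carrier A"
        using gA by (metis imageI)
      moreover have "m \<curlyvee> g \<in> ?F \<inter> G"
        using filter_join(1)[OF filter_F_tau m(1) gA] filter_join(2)[OF G(1) g(1) mA] by simp
      then have "m \<curlyvee> g = mv_one A"
        using FG by simp
      ultimately show False
        using disj m g(2) by blast
    qed
    then have "m \<in> ?F \<inter> G"
      by (intro least filter_Int filter_F_tau G(1)) auto
    then show ?thesis by simp
  qed
  then show ?thesis
    unfolding smmv_subdirectly_irreducible_iff[OF smmv] using m(2) mA by blast
qed

lemma type_I_not_L:
  assumes "type_I A \<tau>"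
  shows "\<not> type_L A \<tau>"
  using assms unfolding type_I_def type_L_def nontrivial_def F_tau_def by auto

end

text \<open>An algebra of type D together with an isomorphism \<open>h\<close> onto the product.\<close>

locale type_D_product = smmv A \<tau> + C: mv_algebra C
  for A :: "'a mv_algebra" (structure) and \<tau> :: "'a \<Rightarrow> 'a" and C :: "'a mv_algebra" +
  fixes B :: "'a set" and h :: "'a \<Rightarrow> 'a \<times> 'a"
  assumes C_si: "mv_subdirectly_irreducible C" and B: "mv_subalgebra B C"
    and hom: "h \<in> mv_hom A (mv_prod (C\<lparr>carrier := B\<rparr>) C)"
    and inj: "inj_on h (carrier A)" and surj: "h ` carrier A = B \<times> carrier C"
    and tau: "\<And>x. x \<in> carrier A \<Longrightarrow> h (\<tau> x) = diag_op (h x)"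
begin

lemma h_closed:
  assumes "x \<in> carrier A"
  shows "fst (h x) \<in> carrier C" "snd (h x) \<in> carrier C"
proof -
  have "h x \<in> B \<times> carrier C"
    using assms surj by blast
  then show "fst (h x) \<in> carrier C" "snd (h x) \<in> carrier C"
    using B by (auto simp: mv_subalgebra_def)
qed

lemma h_zero: "h \<zero> = (\<zero>\<^bsub>C\<^esub>, \<zero>\<^bsub>C\<^esub>)"
  using hom_simps(2)[OF hom] by simp

lemma h_neg:
  assumes "x \<in> carrier A"
  shows "h (\<sim> x) = (\<sim>\<^bsub>C\<^esub> fst (h x), \<sim>\<^bsub>C\<^esub> snd (h x))"
  using hom_simps(4)[OF hom assms] by (cases "h x") simp

lemma h_one: "h (mv_one A) = (mv_one C, mv_one C)"
  by (simp add: mv_one_def h_neg h_zero)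

lemma h_imp:
  assumes "x \<in> carrier A" "y \<in> carrier A"
  shows "h (x \<leadsto> y) = (fst (h x) \<leadsto>\<^bsub>C\<^esub> fst (h y), snd (h x) \<leadsto>\<^bsub>C\<^esub> snd (h y))"
  using hom_simps(5)[OF hom, of "\<sim> x" y] assms
  by (cases "h y") (simp add: mv_imp_def h_neg)

lemma h_tau: "x \<in> carrier A \<Longrightarrow> h (\<tau> x) = (fst (h x), fst (h x))"
  using tau[of x] by (cases "h x") (simp add: diag_op_def)

text \<open>If \<open>m\<close> lies in every nontrivial filter of \<open>C\<close>, then \<open>(1, m)\<close> lies in every nontrivial
  \<open>\<tau>\<close>-filter of the product: an element \<open>(b, c)\<close> of such a filter forces \<open>(1, c)\<close> into it, and if
  \<open>c = 1\<close> then \<open>\<tau> (b, c) = (b, b)\<close> forces \<open>(1, b)\<close> into it.\<close>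

lemma subdirectly_irreducible: "smmv_subdirectly_irreducible A \<tau>"
proof -
  obtain m where m: "m \<in> carrier C" "m \<noteq> mv_one C"
    and least: "\<And>G. mv_filter C G \<Longrightarrow> G \<noteq> {mv_one C} \<Longrightarrow> m \<in> G"
    using C_si C.mv_subdirectly_irreducible_iff by blast
  have "\<sim>\<^bsub>C\<^esub> \<zero>\<^bsub>C\<^esub> \<in> B"
    using B by (simp add: mv_subalgebra_def)
  then have oneB: "mv_one C \<in> B"
    by (simp add: mv_one_def)
  have preimage: "\<exists>z\<in>carrier A. h z = (mv_one C, c)" if "c \<in> carrier C" for c
  proof -
    have "(mv_one C, c) \<in> h ` carrier A"
      unfolding surj using that oneB by simp
    then show ?thesis
      by (auto elim!: imageE intro: sym)
  qed
  obtain e where e: "e \<in> carrier A" "h e = (mv_one C, m)"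
    using preimage m(1) by blast
  have "e \<noteq> mv_one A"
    using e(2) h_one m(2) by auto
  moreover have "e \<in> G" if G: "mv_filter A G" "\<tau> ` G \<subseteq> G" "G \<noteq> {mv_one A}" for G
  proof -
    define H where "H = {c \<in> carrier C. \<exists>g\<in>G. h g = (mv_one C, c)}"
    have "mv_filter C H"
    proof (rule C.filterI)
      fix a b assume a: "a \<in> H" and b: "b \<in> carrier C" and ab: "a \<leadsto>\<^bsub>C\<^esub> b \<in> H"
      obtain g where g: "g \<in> G" "h g = (mv_one C, a)"
        using a by (auto simp: H_def)
      obtain k where k: "k \<in> G" "h k = (mv_one C, a \<leadsto>\<^bsub>C\<^esub> b)"
        using ab by (auto simp: H_def)
      obtain z where z: "z \<in> carrier A" "h z = (mv_one C, b)"
        using preimage b by blast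
      have cl: "g \<in> carrier A" "k \<in> carrier A"
        using g k filter_subset[OF G(1)] by simp_all
      then have "h (g \<leadsto> z) = h k"
        using h_imp[OF cl(1) z(1)] g k z by simp
      then have "g \<leadsto> z = k"
        using inj_onD[OF inj] cl z(1) by simp
      then have "z \<in> G"
        using filter_mp[OF G(1) g(1)] k(1) z(1) by simp
      then show "b \<in> H"
        using z(2) b by (auto simp: H_def)
    qed (use h_one filter_one[OF G(1)] in \<open>auto simp: H_def\<close>)
    moreover have snd_H: "snd (h g) \<in> H" if "g \<in> G" for g
    proof -
      have gA: "g \<in> carrier A"
        using that filter_subset[OF G(1)] by simp
      obtain z where z: "z \<in> carrier A" "h z = (mv_one C, snd (h g))"
        using preimage h_closed[OF gA] by blast
      have "h (g \<leadsto> z) = h (mv_one A)"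
        using h_imp[OF gA z(1)] z(2) h_one h_closed[OF gA] by simp
      then have "g \<leadsto> z = mv_one A"
        using inj_onD[OF inj] gA z(1) by simp
      then have "z \<in> G"
        using filter_mp[OF G(1) that] filter_one[OF G(1)] z(1) by simp
      then show ?thesis
        using z(2) h_closed[OF gA] by (auto simp: H_def)
    qed
    moreover have "H \<noteq> {mv_one C}"
    proof
      assume H: "H = {mv_one C}"
      obtain g where g: "g \<in> G" "g \<noteq> mv_one A"
        using G(1,3) filter_one by blast
      have gA: "g \<in> carrier A" and tg: "\<tau> g \<in> G"
        using g(1) G(1,2) filter_subset by blast+
      have "snd (h g) = mv_one C" "fst (h g) = mv_one C"
        using snd_H[OF g(1)] snd_H[OF tg] h_tau[OF gA] H by simp_all
      then have "h g = h (mv_one A)"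
        using h_one by (simp add: prod_eq_iff)
      then show False
        using inj_onD[OF inj] gA g(2) by simp
    qed
    ultimately have "m \<in> H"
      using least by blast
    then obtain g where "g \<in> G" "h g = h e"
      using e(2) by (auto simp: H_def)
    moreover from this have "g = e"
      using inj_onD[OF inj] e(1) filter_subset[OF G(1)] by blast
    ultimately show ?thesis by simp
  qed
  ultimately show ?thesis
    unfolding smmv_subdirectly_irreducible_iff[OF smmv] using e(1) by blast
qed

lemma zero_neq_one: "\<zero>\<^bsub>C\<^esub> \<noteq> mv_one C"
proof -
  obtain m where "m \<in> carrier C" "m \<noteq> mv_one C"
    using C_si C.mv_subdirectly_irreducible_iff by blast
  then show ?thesis
    by (metis C.one_imp C.zero_imp)
qed

lemma complement:
  obtains e where "e \<in> carrier A" "h e = (\<zero>\<^bsub>C\<^esub>, mv_one C)"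
proof -
  have "(\<zero>\<^bsub>C\<^esub>, mv_one C) \<in> h ` carrier A"
    unfolding surj using B C.one_closed by (simp add: mv_subalgebra_def)
  then show ?thesis
    using that by (auto elim!: imageE)
qed

lemma tau_not_identity: "\<exists>x\<in>carrier A. \<tau> x \<noteq> x"
proof -
  obtain e where e: "e \<in> carrier A" "h e = (\<zero>\<^bsub>C\<^esub>, mv_one C)"
    by (rule complement)
  then have "h (\<tau> e) \<noteq> h e"
    using zero_neq_one by (simp add: h_tau)
  then show ?thesis
    using e(1) by metis
qed

lemma not_local: "\<not> mv_local A"
proof
  assume local: "mv_local A"
  let ?S = "{x \<in> carrier A. snd (h x) = mv_one C}" and ?T = "{x \<in> carrier A. fst (h x) = mv_one C}"
  obtain e where e: "e \<in> carrier A" "h e = (\<zero>\<^bsub>C\<^esub>, mv_one C)"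
    by (rule complement)
  have S: "mv_filter A ?S"
    by (rule filterI) (auto simp: h_one h_imp h_closed)
  have T: "mv_filter A ?T"
    by (rule filterI) (auto simp: h_one h_imp h_closed)
  have "\<zero> \<notin> ?S" "\<zero> \<notin> ?T"
    using zero_neq_one by (simp_all add: h_zero)
  then have "?S \<noteq> carrier A" "?T \<noteq> carrier A"
    using zero_closed by blast+
  moreover have "e \<in> ?S" "\<sim> e \<in> ?T"
    using e h_neg[OF e(1)] by (simp_all add: mv_one_def)
  ultimately show False
    using local_no_complements[OF local S _ _ T] by blast
qed

end

lemma (in smmv) type_D_product:
  assumes "type_D A \<tau>"
  shows "\<exists>C B h. type_D_product A \<tau> C B h"
proof -
  obtain B and C :: "'a mv_algebra" and h
    where C: "mv_subdirectly_irreducible C" and B: "mv_subalgebra B C"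
      and "h \<in> mv_hom A (mv_prod (C\<lparr>carrier := B\<rparr>) C)"
      and "bij_betw h (carrier A) (B \<times> carrier C)"
      and "\<forall>x\<in>carrier A. h (\<tau> x) = diag_op (h x)"
    using assms by (auto simp: type_D_def smmv_isomorphic_def)
  then have "type_D_product A \<tau> C B h"
    using smmv_axioms
    by (intro type_D_product.intro type_D_product_axioms.intro)
      (simp_all add: mv_subdirectly_irreducible_def bij_betw_def)
  then show ?thesis
    by blast
qed

theorem theorem4p3:
  fixes A :: "'a mv_algebra" and \<tau> :: "'a \<Rightarrow> 'a"
  assumes "smmv_algebra A \<tau>"
  shows "(smmv_subdirectly_irreducible A \<tau> \<longleftrightarrow> type_I A \<tau> \<or> type_L A \<tau> \<or> type_D A \<tau>) \<and>
    \<not> (type_I A \<tau> \<and> type_L A \<tau>) \<and>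
    \<not> (type_I A \<tau> \<and> type_D A \<tau>) \<and>
    \<not> (type_L A \<tau> \<and> type_D A \<tau>)"
proof -
  interpret smmv A \<tau>
    using assms by (intro smmv.intro smmv_axioms.intro) (simp_all add: smmv_algebra_def)
  have D: "smmv_subdirectly_irreducible A \<tau>" "\<exists>x\<in>carrier A. \<tau> x \<noteq> x" "\<not> mv_local A"
    if "type_D A \<tau>"
  proof -
    obtain C B h where "type_D_product A \<tau> C B h"
      using type_D_product[OF \<open>type_D A \<tau>\<close>] by blast
    then interpret type_D_product A \<tau> C B h .
    show "smmv_subdirectly_irreducible A \<tau>" "\<exists>x\<in>carrier A. \<tau> x \<noteq> x" "\<not> mv_local A"
      by (rule subdirectly_irreducible tau_not_identity not_local)+
  qed
  have I: "smmv_subdirectly_irreducible A \<tau>" if "type_I A \<tau>"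
    using that type_I_iff by (simp add: type_I_def)
  have "type_I A \<tau> \<or> type_L A \<tau> \<or> type_D A \<tau>" if si: "smmv_subdirectly_irreducible A \<tau>"
  proof (cases "F_tau A \<tau> = {mv_one A}")
    case True
    then have "\<forall>x\<in>carrier A. \<tau> x = x"
      using tau_identity by blast
    then show ?thesis
      using si type_I_iff by (simp add: type_I_def)
  next
    case False
    then show ?thesis
      using type_L_or_D[OF si] by blast
  qed
  moreover have "\<not> (type_I A \<tau> \<and> type_D A \<tau>)"
    using D(2) by (auto simp: type_I_def)
  moreover have "\<not> (type_L A \<tau> \<and> type_D A \<tau>)"
    using D(3) by (auto simp: type_L_def)
  ultimately show ?thesis
    using I type_L_subdirectly_irreducible D(1) type_I_not_L by blast
qed

end
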